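(* Let $\mathcal{I}$ be an ideal and let $n\ge 3$. Every $n$-$\mathcal{I}$-generic set computes an $n$-$COMP$-generic set.
   Context: Sets are subsets of $\omega$. A (Turing) ideal is a (countable) collection of sets closed under $\le_T$ and $\oplus$. Each ideal $\mathcal{I}$ is presented by a fixed exact pair $A_0,A_1$ (so $S\in\mathcal{I}$ iff $S\le_T A_0$ and $S\le_T A_1$), and $\Sigma^0_n(\mathcal{I})$ means $\Sigma^0_n(A_0\oplus A_1)$. $COMP$ is the ideal of computable sets (presented by a computable exact pair, so $\Sigma^0_n(COMP)=\Sigma^0_n$). A Mathias condition is a pair $(D,S)$ with $D$ finite, $S$ infinite, $\max D<\min S$; $(\widetilde D,\widetilde S)$ extends $(D,S)$ if $D\subseteq\widetilde D\subseteq D\cup S$ and $\widetilde S\subseteq S$. A set $X$ satisfies $(D,S)$ if $D\subseteq X\subseteq D\cup S$; $X$ meets a collection $\mathcal{C}$ of conditions if it satisfies a member of $\mathcal{C}$, and avoids $\mathcal{C}$ if it satisfies a condition with no extension in $\mathcal{C}$. An $\mathcal{I}$-condition is a Mathias condition $(D,S)$ with $S\in\mathcal{I}$. A set $G$ is $n$-$\mathcal{I}$-generic if it meets or avoids every $\Sigma^0_n(\mathcal{I})$-definable collection of $\mathcal{I}$-conditions. *)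

theory Defs
  imports Main "HOL-Library.Nat_Bijection" "HOL-Library.Countable_Set"
begin

section \<open>Oracle computability\<close>

text \<open>
  Partial recursive functions relative to an oracle, as unary functions on the naturals with
  tuples coded by \<^const>\<open>prod_encode\<close>. \<open>Query\<close> asks the oracle for its
  characteristic function.
\<close>

datatype code =
    Zero | Succ | Fst | Snd | Query
  | Pairing code code | Compose code code | PrimRec code code | Minimize code

definition char_fun :: "nat set \<Rightarrow> nat \<Rightarrow> nat" where
  "char_fun A x = (if x \<in> A then 1 else 0)"

inductive evals :: "nat set \<Rightarrow> code \<Rightarrow> nat \<Rightarrow> nat \<Rightarrow> bool" for A :: "nat set" where
  Zero: "evals A Zero x 0"
| Succ: "evals A Succ x (Suc x)"
| Fst: "evals A Fst (prod_encode (x, y)) x"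
| Snd: "evals A Snd (prod_encode (x, y)) y"
| Query: "evals A Query x (char_fun A x)"
| Pairing: "evals A c x y \<Longrightarrow> evals A d x z \<Longrightarrow> evals A (Pairing c d) x (prod_encode (y, z))"
| Compose: "evals A d x y \<Longrightarrow> evals A c y z \<Longrightarrow> evals A (Compose c d) x z"
| PrimRec_0: "evals A c x y \<Longrightarrow> evals A (PrimRec c d) (prod_encode (x, 0)) y"
| PrimRec_Suc: "evals A (PrimRec c d) (prod_encode (x, k)) y \<Longrightarrow>
    evals A d (prod_encode (x, prod_encode (k, y))) z \<Longrightarrow>
    evals A (PrimRec c d) (prod_encode (x, Suc k)) z"
| Minimize: "evals A c (prod_encode (x, y)) 0 \<Longrightarrow>
    (\<forall>k<y. \<exists>v. evals A c (prod_encode (x, k)) (Suc v)) \<Longrightarrow>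
    evals A (Minimize c) x y"

inductive_cases evals_ZeroE: "evals A Zero x y"
inductive_cases evals_SuccE: "evals A Succ x y"
inductive_cases evals_FstE: "evals A Fst x y"
inductive_cases evals_SndE: "evals A Snd x y"
inductive_cases evals_QueryE: "evals A Query x y"
inductive_cases evals_PairingE: "evals A (Pairing c d) x y"
inductive_cases evals_ComposeE: "evals A (Compose c d) x y"
inductive_cases evals_PrimRecE: "evals A (PrimRec c d) x y"
inductive_cases evals_MinimizeE: "evals A (Minimize c) x y"

lemma evals_deterministic: "evals A c x y \<Longrightarrow> evals A c x z \<Longrightarrow> y = z"
proof (induction arbitrary: z rule: evals.induct)
  case (Zero x)
  then show ?case by (auto elim: evals_ZeroE)
next
  case (Succ x)
  then show ?case by (auto elim: evals_SuccE)
next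
  case (Fst x y)
  then show ?case by (auto elim: evals_FstE)
next
  case (Snd x y)
  then show ?case by (auto elim: evals_SndE)
next
  case (Query x)
  then show ?case by (auto elim: evals_QueryE)
next
  case (Pairing c x y d w)
  from Pairing.prems show ?case
    by (rule evals_PairingE) (use Pairing.IH in blast)
next
  case (Compose d x y c w)
  from Compose.prems show ?case
    by (rule evals_ComposeE) (use Compose.IH in blast)
next
  case (PrimRec_0 c x y d)
  from PrimRec_0.prems show ?case
    by (rule evals_PrimRecE) (use PrimRec_0.IH in auto)
next
  case (PrimRec_Suc c d x k y w)
  from PrimRec_Suc.prems show ?case
    by (rule evals_PrimRecE) (use PrimRec_Suc.IH in auto)
next
  case (Minimize c x y)
  from Minimize.prems show ?case
  proof (rule evals_MinimizeE)
    assume z: "evals A c (prod_encode (x, z)) 0"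
      and below: "\<forall>k<z. \<exists>v. evals A c (prod_encode (x, k)) (Suc v)"
    have "\<not> y < z"
      using below Minimize.IH by (metis nat.distinct(1))
    moreover have "\<not> z < y"
      using z Minimize.IH by (metis nat.distinct(1))
    ultimately show ?thesis by simp
  qed
qed

fun encode_code :: "code \<Rightarrow> nat" where
  "encode_code Zero = 0"
| "encode_code Succ = 1"
| "encode_code Fst = 2"
| "encode_code Snd = 3"
| "encode_code Query = 4"
| "encode_code (Pairing c d) = 5 + 4 * prod_encode (encode_code c, encode_code d)"
| "encode_code (Compose c d) = 6 + 4 * prod_encode (encode_code c, encode_code d)"
| "encode_code (PrimRec c d) = 7 + 4 * prod_encode (encode_code c, encode_code d)"
| "encode_code (Minimize c) = 8 + 4 * encode_code c"

lemma inj_encode_code: "inj encode_code"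
proof (rule injI)
  show "encode_code c = encode_code d \<Longrightarrow> c = d" for c d
  proof (induction c arbitrary: d)
    case (Pairing c1 c2)
    then show ?case by (cases d) (auto, presburger+)
  next
    case (Compose c1 c2)
    then show ?case by (cases d) (auto, presburger+)
  next
    case (PrimRec c1 c2)
    then show ?case by (cases d) (auto, presburger+)
  next
    case (Minimize c)
    then show ?case by (cases d) (auto, presburger+)
  qed (case_tac d; simp)+
qed

text \<open>\<open>computes A e S\<close>: the \<open>e\<close>-th Turing functional with oracle \<open>A\<close> is total and equals the
  characteristic function of \<open>S\<close>. Numbers that code no program compute nothing.\<close>

definition computes :: "nat set \<Rightarrow> nat \<Rightarrow> nat set \<Rightarrow> bool" where
  "computes A e S \<longleftrightarrow> (\<exists>c. encode_code c = e \<and> (\<forall>x. evals A c x (char_fun S x)))"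

definition turing_le :: "nat set \<Rightarrow> nat set \<Rightarrow> bool" (infix "\<le>\<^sub>T" 50) where
  "S \<le>\<^sub>T A \<longleftrightarrow> (\<exists>e. computes A e S)"

definition turing_join :: "nat set \<Rightarrow> nat set \<Rightarrow> nat set" (infixl "\<oplus>\<^sub>T" 65) where
  "A \<oplus>\<^sub>T B = {2 * x |x. x \<in> A} \<union> {2 * x + 1 |x. x \<in> B}"

text \<open>A set is \<open>\<Sigma>\<^sub>0\<close> in \<open>A\<close> if it is computable in \<open>A\<close>, and \<open>\<Sigma>\<^sub>n\<^sub>+\<^sub>1\<close> in \<open>A\<close> if it is a projection
  of the complement of a set that is \<open>\<Sigma>\<^sub>n\<close> in \<open>A\<close>.\<close>

fun Sigma0 :: "nat \<Rightarrow> nat set \<Rightarrow> nat set set" where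
  "Sigma0 0 A = {S. S \<le>\<^sub>T A}"
| "Sigma0 (Suc n) A = {{x. \<exists>y. prod_encode (x, y) \<notin> P} |P. P \<in> Sigma0 n A}"


section \<open>Turing ideals\<close>

definition turing_ideal :: "nat set set \<Rightarrow> bool" where
  "turing_ideal I \<longleftrightarrow> I \<noteq> {} \<and> countable I \<and>
     (\<forall>S\<in>I. \<forall>R. R \<le>\<^sub>T S \<longrightarrow> R \<in> I) \<and> (\<forall>R\<in>I. \<forall>S\<in>I. R \<oplus>\<^sub>T S \<in> I)"

definition exact_pair :: "nat set set \<Rightarrow> nat set \<Rightarrow> nat set \<Rightarrow> bool" where
  "exact_pair I A0 A1 \<longleftrightarrow> (\<forall>S. S \<in> I \<longleftrightarrow> S \<le>\<^sub>T A0 \<and> S \<le>\<^sub>T A1)"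

definition COMP :: "nat set set" where
  "COMP = {S. S \<le>\<^sub>T {}}"

lemma exact_pair_COMP: "exact_pair COMP {} {}"
  by (simp add: exact_pair_def COMP_def)


section \<open>Mathias forcing\<close>

type_synonym condition = "nat set \<times> nat set"

definition mathias_condition :: "condition \<Rightarrow> bool" where
  "mathias_condition = (\<lambda>(D, S). finite D \<and> infinite S \<and> (\<forall>d\<in>D. \<forall>s\<in>S. d < s))"

definition ideal_condition :: "nat set set \<Rightarrow> condition \<Rightarrow> bool" where
  "ideal_condition I p \<longleftrightarrow> mathias_condition p \<and> snd p \<in> I"

definition extends :: "condition \<Rightarrow> condition \<Rightarrow> bool" where
  "extends = (\<lambda>(D', S') (D, S). D \<subseteq> D' \<and> D' \<subseteq> D \<union> S \<and> S' \<subseteq> S)"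

definition satisfies :: "nat set \<Rightarrow> condition \<Rightarrow> bool" where
  "satisfies X = (\<lambda>(D, S). D \<subseteq> X \<and> X \<subseteq> D \<union> S)"

definition meets :: "nat set \<Rightarrow> condition set \<Rightarrow> bool" where
  "meets X C \<longleftrightarrow> (\<exists>p\<in>C. satisfies X p)"

text \<open>The avoiding condition has to be a condition of the forcing notion at hand. With arbitrary
  Mathias conditions \<open>(D, S)\<close>, every infinite set \<open>X\<close> without an infinite subset in \<open>I\<close> would
  avoid every collection of \<open>I\<close>-conditions through \<open>({}, X)\<close>.\<close>

definition avoids :: "nat set set \<Rightarrow> nat set \<Rightarrow> condition set \<Rightarrow> bool" where
  "avoids I X C \<longleftrightarrow>
     (\<exists>p. ideal_condition I p \<and> satisfies X p \<and> \<not> (\<exists>q\<in>C. extends q p))"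

text \<open>An index of \<open>(D, S)\<close> relative to an exact pair consists of the canonical index of the finite
  set \<open>D\<close> and indices of \<open>S\<close> relative to both members of the pair.\<close>

definition condition_index :: "nat set \<Rightarrow> nat set \<Rightarrow> nat \<Rightarrow> condition \<Rightarrow> bool" where
  "condition_index A0 A1 i = (\<lambda>(D, S). \<exists>e0 e1.
     i = prod_encode (set_encode D, prod_encode (e0, e1)) \<and>
     computes A0 e0 S \<and> computes A1 e1 S)"

definition Sigma0_collection ::
    "nat \<Rightarrow> nat set set \<Rightarrow> nat set \<Rightarrow> nat set \<Rightarrow> condition set \<Rightarrow> bool" where
  "Sigma0_collection n I A0 A1 C \<longleftrightarrow>
     (\<forall>p\<in>C. ideal_condition I p) \<and>
     {i. \<exists>p\<in>C. condition_index A0 A1 i p} \<in> Sigma0 n (A0 \<oplus>\<^sub>T A1)"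

text \<open>\<open>mathias_generic n I A0 A1 G\<close>: \<open>G\<close> is \<open>n\<close>-\<open>I\<close>-generic, for \<open>I\<close> presented by the exact pair
  \<open>A0\<close>, \<open>A1\<close>.\<close>

definition mathias_generic ::
    "nat \<Rightarrow> nat set set \<Rightarrow> nat set \<Rightarrow> nat set \<Rightarrow> nat set \<Rightarrow> bool" where
  "mathias_generic n I A0 A1 G \<longleftrightarrow>
     (\<forall>C. Sigma0_collection n I A0 A1 C \<longrightarrow> meets G C \<or> avoids I G C)"

end

theory Submission
  imports Defs
begin

text \<open>
  Suppose first that some \<open>B \<in> I\<close> below \<open>G\<close> has a \<open>\<Sigma>\<^sub>1(B)\<close> set \<open>Q \<notin> I\<close>. No infinite \<open>S \<in> I\<close> is sparse enough
  for its consecutive elements to bound the settling times of \<open>Q\<close>, so below every \<open>I\<close>-condition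
  one may choose freely whether the next gap of \<open>G\<close> exceeds the settling time or not. \<open>G\<close> reads
  these bits with a delay of one element, so arbitrary numbers, in particular indices of computable
  conditions, can be coded into \<open>G\<close>. A stack of such indices is maintained along \<open>G\<close>; an index
  that is not total, or that leaves a finite reservoir, eventually fails the bounded searches and is
  popped, while the honest entries survive because \<open>G\<close> can be made to grow faster than their search
  times. The finite parts of the accepted indices form \<open>H\<close>,
  and each extension of the computable condition currently on the stack can be forced by
  extending the \<open>I\<close>-condition.

  Otherwise every \<open>\<Sigma>\<^sub>1(B)\<close> set with \<open>B \<in> I\<close>, \<open>B\<close> below \<open>G\<close>, is in \<open>I\<close>. Then \<open>G\<close> dominates its settling times
  and hence computes it. Thus \<open>G\<close> computes all arithmetical sets, among them a generic
  built by the usual step-by-step construction.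
\<close>

section \<open>Functions computable in an oracle\<close>

text \<open>Recognising an index of a computable condition takes two alternating quantifiers, so G
  cannot tell honest indices from the others it decodes. The same complexity, relative to the exact
  pair, is the source of n \<ge> 3: the collections to be met ask that a reservoir be total and
  infinite, a Pi_2 question. The case split is forced by the coding. If Q were in I, reservoirs in I
  could be thinned until every gap bounds the settling time, and all bits would be 0; and B has to
  lie below G for G to see the bits at all. The link between the two forcings is the notion of a
  clean condition: it forces the present stack to survive, hence forces H to satisfy the computable
  condition described by the decoder state. Extensions of that computable condition are matched by
  extensions of the clean one, so for a given collection C of computable conditions, genericity of G
  is applied to the I-conditions that force H into a member of C.\<close>

definition pi1 :: "nat \<Rightarrow> nat" where "pi1 n = fst (prod_decode n)"
definition pi2 :: "nat \<Rightarrow> nat" where "pi2 n = snd (prod_decode n)"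

abbreviation pe :: "nat \<Rightarrow> nat \<Rightarrow> nat" where "pe a b \<equiv> prod_encode (a, b)"

lemma pi_pe [simp]: "pi1 (pe a b) = a" "pi2 (pe a b) = b" "pe (pi1 n) (pi2 n) = n"
  by (simp_all add: pi1_def pi2_def)

lemma pi_0 [simp]: "pi1 0 = 0" "pi2 0 = 0"
  by (simp_all add: pi1_def pi2_def prod_decode_def prod_decode_aux.simps)

lemma set_decode_less: "x \<in> set_decode n \<Longrightarrow> x < n"
proof -
  assume "x \<in> set_decode n"
  then have "n div 2 ^ x \<noteq> 0" by (auto simp: set_decode_def intro: ccontr)
  then have "2 ^ x \<le> n" by (metis div_less not_le)
  then show "x < n" using less_exp[of x] by linarith
qed

text \<open>
  Several variables are passed as one number. The rules for recursion, bounded quantifiers and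
  least witnesses replace the bound variables by projections of that number, so that a single
  \<open>intro comp_intros\<close> decides explicitly given predicates.
\<close>

definition compf :: "nat set \<Rightarrow> (nat \<Rightarrow> nat) \<Rightarrow> bool" where
  "compf A f \<longleftrightarrow> (\<exists>c. \<forall>x. evals A c x (f x))"

definition decp :: "nat set \<Rightarrow> (nat \<Rightarrow> bool) \<Rightarrow> bool" where
  "decp A P \<longleftrightarrow> compf A (\<lambda>x. if P x then 1 else 0)"

named_theorems comp_intros

lemma turing_le_decp: "S \<le>\<^sub>T A \<longleftrightarrow> decp A (\<lambda>x. x \<in> S)"
  by (auto simp: turing_le_def computes_def decp_def compf_def char_fun_def)

lemma compf_const0: "compf A (\<lambda>x. 0)"
  unfolding compf_def using evals.Zero by blast

lemma compf_pi1_id: "compf A pi1" and compf_pi2_id: "compf A pi2"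
  unfolding compf_def by (metis evals.Fst pi_pe(3), metis evals.Snd pi_pe(3))

lemma compf_pe [comp_intros]: "compf A f \<Longrightarrow> compf A g \<Longrightarrow> compf A (\<lambda>x. pe (f x) (g x))"
  unfolding compf_def by (meson evals.Pairing)

lemma compf_comp: "compf A f \<Longrightarrow> compf A g \<Longrightarrow> compf A (\<lambda>x. f (g x))"
  unfolding compf_def by (meson evals.Compose)

lemmas compf_pi1 [comp_intros] = compf_comp[OF compf_pi1_id]
lemmas compf_pi2 [comp_intros] = compf_comp[OF compf_pi2_id]

lemma compf_id [comp_intros]: "compf A (\<lambda>x. x)"
  using compf_pe[OF compf_pi1_id compf_pi2_id] by simp

lemma compf_Suc [comp_intros]: "compf A f \<Longrightarrow> compf A (\<lambda>x. Suc (f x))"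
  by (rule compf_comp[of A Suc]) (auto simp: compf_def intro: evals.Succ)

lemma compf_const [comp_intros]: "compf A (\<lambda>x. k)"
  by (induction k) (simp_all add: compf_const0 compf_Suc)

lemma compf_rec [comp_intros]:
  assumes g: "compf A g"
    and h: "compf A (\<lambda>p. h (pi1 p) (pi1 (pi2 p)) (pi2 (pi2 p)))"
    and n: "compf A n"
  shows "compf A (\<lambda>e. rec_nat (g e) (h e) (n e))"
proof -
  obtain c where c: "\<And>x. evals A c x (g x)" using g by (auto simp: compf_def)
  obtain d where d: "\<And>p. evals A d p (h (pi1 p) (pi1 (pi2 p)) (pi2 (pi2 p)))"
    using h by (auto simp: compf_def)
  have ev: "evals A (PrimRec c d) (pe x k) (rec_nat (g x) (h x) k)" for x k
  proof (induction k)
    case 0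
    show ?case using evals.PrimRec_0[OF c] by simp
  next
    case (Suc k)
    show ?case
      using evals.PrimRec_Suc[OF Suc d] by simp
  qed
  have "compf A (\<lambda>p. rec_nat (g (pi1 p)) (h (pi1 p)) (pi2 p))"
    unfolding compf_def by (metis ev pi_pe(3))
  from compf_comp[OF this compf_pe[OF compf_id n]] show ?thesis by simp
qed

lemma compf_funpow [comp_intros]:
  assumes "compf A g" "compf A (\<lambda>p. h (pi1 p) (pi2 p))" "compf A n"
  shows "compf A (\<lambda>e. (h e ^^ n e) (g e))"
proof -
  have *: "(f ^^ k) y = rec_nat y (\<lambda>_. f) k" for f :: "nat \<Rightarrow> nat" and k y
    by (induction k) auto
  have "compf A (\<lambda>p. h (pi1 p) (pi2 (pi2 p)))"
    using compf_comp[OF assms(2), of "\<lambda>p. pe (pi1 p) (pi2 (pi2 p))"]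
    by (simp add: comp_intros)
  then show ?thesis unfolding * by (intro compf_rec assms)
qed

lemma compf_add [comp_intros]: "compf A f \<Longrightarrow> compf A g \<Longrightarrow> compf A (\<lambda>x. f x + g x)"
proof -
  have *: "a + b = rec_nat a (\<lambda>_ y. Suc y) b" for a b by (induction b) auto
  show "compf A f \<Longrightarrow> compf A g \<Longrightarrow> ?thesis"
    unfolding * by (intro comp_intros)
qed

lemma compf_mult [comp_intros]: "compf A f \<Longrightarrow> compf A g \<Longrightarrow> compf A (\<lambda>x. f x * g x)"
proof -
  have *: "a * b = rec_nat 0 (\<lambda>_ y. y + a) b" for a b by (induction b) auto
  assume "compf A f" "compf A g"
  then show ?thesis
    unfolding * by (intro comp_intros; simp add: compf_pi1 compf_comp compf_id)
qed

lemma compf_diff [comp_intros]: "compf A f \<Longrightarrow> compf A g \<Longrightarrow> compf A (\<lambda>x. f x - g x)"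
proof -
  have *: "a - b = rec_nat a (\<lambda>_ y. rec_nat 0 (\<lambda>k _. k) y) b" for a b :: nat
  proof (induction b)
    case (Suc b)
    have "n - 1 = rec_nat 0 (\<lambda>k _. k) n" for n :: nat by (cases n) auto
    from this[of "a - b"] show ?case unfolding nat.rec(2) Suc[symmetric] by simp
  qed simp
  show "compf A f \<Longrightarrow> compf A g \<Longrightarrow> ?thesis"
    unfolding * by (intro comp_intros)
qed

lemma compf_pow2 [comp_intros]: "compf A f \<Longrightarrow> compf A (\<lambda>x. 2 ^ f x)"
proof -
  have *: "2 ^ b = rec_nat (1::nat) (\<lambda>_ y. y * 2) b" for b by (induction b) auto
  show "compf A f \<Longrightarrow> ?thesis" unfolding * by (intro comp_intros)
qed

lemma compf_cond: "compf A b \<Longrightarrow> compf A f \<Longrightarrow> compf A g \<Longrightarrow>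
    compf A (\<lambda>x. if b x = 0 then g x else f x)"
proof -
  have *: "(if b = 0 then v else u) = rec_nat v (\<lambda>_ _. u) b" for b u v :: nat by (cases b) auto
  assume "compf A b" "compf A f" "compf A g"
  then show ?thesis
    unfolding * by (intro comp_intros) (auto intro: compf_comp compf_pi1_id)
qed

lemma compf_if [comp_intros]:
  assumes "decp A P" "compf A f" "compf A g"
  shows "compf A (\<lambda>x. if P x then f x else g x)"
proof -
  have "(if P x then f x else g x) = (if (if P x then 1 else 0 :: nat) = 0 then g x else f x)" for x
    by simp
  then show ?thesis
    using compf_cond[OF assms(1)[unfolded decp_def] assms(2,3)] by simp
qed

lemma decp_eq0: "compf A f \<Longrightarrow> decp A (\<lambda>x. f x = 0)"
  unfolding decp_def by (intro compf_cond comp_intros)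

lemma decp_not [comp_intros]: "decp A P \<Longrightarrow> decp A (\<lambda>x. \<not> P x)"
proof -
  assume "decp A P"
  then have "compf A (\<lambda>x. if P x then 0 else 1)" by (intro comp_intros)
  moreover have "(if P x then 0 else 1) = (if \<not> P x then 1 else 0 :: nat)" for x by simp
  ultimately show ?thesis unfolding decp_def by simp
qed

lemma decp_const [comp_intros]: "decp A (\<lambda>x. b)"
  unfolding decp_def by (rule compf_const)

lemma decp_if:
  assumes "decp A P" "decp A Q" "decp A R"
  shows "decp A (\<lambda>x. if P x then Q x else R x)"
proof -
  have "(\<lambda>x. if (if P x then Q x else R x) then 1 else 0 :: nat) =
      (\<lambda>x. if P x then (if Q x then 1 else 0) else (if R x then 1 else 0))"
    by auto
  then show ?thesis
    using compf_if[OF assms(1) assms(2,3)[unfolded decp_def]] unfolding decp_def by simp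
qed

lemma decp_conj [comp_intros]: "decp A P \<Longrightarrow> decp A Q \<Longrightarrow> decp A (\<lambda>x. P x \<and> Q x)"
proof -
  assume "decp A P" "decp A Q"
  then have "decp A (\<lambda>x. if P x then Q x else False)" by (intro decp_if decp_const)
  moreover have "(\<lambda>x. if P x then Q x else False) = (\<lambda>x. P x \<and> Q x)" by auto
  ultimately show ?thesis by simp
qed

lemma decp_disj [comp_intros]: "decp A P \<Longrightarrow> decp A Q \<Longrightarrow> decp A (\<lambda>x. P x \<or> Q x)"
  using decp_not[OF decp_conj[OF decp_not[of A P] decp_not[of A Q]]] by simp

lemma decp_imp [comp_intros]: "decp A P \<Longrightarrow> decp A Q \<Longrightarrow> decp A (\<lambda>x. P x \<longrightarrow> Q x)"
  using decp_not[OF decp_conj[OF _ decp_not[of A Q], of P]] by simp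

lemma decp_le [comp_intros]: "compf A f \<Longrightarrow> compf A g \<Longrightarrow> decp A (\<lambda>x. f x \<le> g x)"
  using decp_eq0[of A "\<lambda>x. f x - g x"] compf_diff[of A f g] by simp

lemma decp_less [comp_intros]: "compf A f \<Longrightarrow> compf A g \<Longrightarrow> decp A (\<lambda>x. f x < g x)"
  using decp_le[of A "\<lambda>x. Suc (f x)" g] compf_Suc[of A f] by (simp add: Suc_le_eq)

lemma decp_eq [comp_intros]: "compf A f \<Longrightarrow> compf A g \<Longrightarrow> decp A (\<lambda>x. f x = g x)"
  using decp_conj[OF decp_le[of A f g] decp_le[of A g f]] by (simp add: eq_iff)

lemma decp_comp: "decp A P \<Longrightarrow> compf A f \<Longrightarrow> decp A (\<lambda>x. P (f x))"
  unfolding decp_def by (rule compf_comp)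

lemma decp_ex_less [comp_intros]:
  assumes P: "decp A (\<lambda>p. P (pi1 p) (pi2 p))" and b: "compf A b"
  shows "decp A (\<lambda>e. \<exists>k<b e. P e k)"
proof -
  have *: "(if \<exists>k<m. P e k then 1 else 0) = rec_nat 0 (\<lambda>k y. if P e k then 1 else y) m" for e m
  proof (induction m)
    case (Suc m)
    have "(\<exists>k<Suc m. P e k) \<longleftrightarrow> P e m \<or> (\<exists>k<m. P e k)" by (auto simp: less_Suc_eq)
    then show ?case unfolding nat.rec(2) Suc[symmetric] by simp
  qed simp
  have "decp A (\<lambda>p. P (pi1 p) (pi1 (pi2 p)))"
    using decp_comp[OF P, of "\<lambda>p. pe (pi1 p) (pi1 (pi2 p))"]
    by (simp add: comp_intros)
  then have "compf A (\<lambda>e. rec_nat 0 (\<lambda>k y. if P e k then 1 else y) (b e))"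
    by (intro compf_rec compf_if comp_intros b)
  then show ?thesis unfolding decp_def * .
qed

lemma decp_all_less [comp_intros]:
  assumes P: "decp A (\<lambda>p. P (pi1 p) (pi2 p))" and b: "compf A b"
  shows "decp A (\<lambda>e. \<forall>k<b e. P e k)"
  using decp_not[OF decp_ex_less[OF decp_not[OF P] b]] by simp

lemma decp_ex_le [comp_intros]:
  assumes P: "decp A (\<lambda>p. P (pi1 p) (pi2 p))" and b: "compf A b"
  shows "decp A (\<lambda>e. \<exists>k\<le>b e. P e k)"
  using decp_ex_less[OF P compf_Suc[OF b]] by (simp add: less_Suc_eq_le)

lemma decp_all_le [comp_intros]:
  assumes P: "decp A (\<lambda>p. P (pi1 p) (pi2 p))" and b: "compf A b"
  shows "decp A (\<lambda>e. \<forall>k\<le>b e. P e k)"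
  using decp_all_less[OF P compf_Suc[OF b]] by (simp add: less_Suc_eq_le)

lemma decp_set_decode [comp_intros]:
  assumes f: "compf A f" and g: "compf A g"
  shows "decp A (\<lambda>e. f e \<in> set_decode (g e))"
proof -
  \<comment> \<open>Division is expressed by a bounded search for quotient and remainder: bit x is
    set iff the quotient of n by 2^x is odd.\<close>
  have *: "x \<in> set_decode n \<longleftrightarrow> (\<exists>q\<le>n. \<exists>r<2^x. n = (2 * q + 1) * 2 ^ x + r)" for x n
  proof
    assume "x \<in> set_decode n"
    then have "odd (n div 2 ^ x)" by (simp add: set_decode_def)
    then obtain q where q: "n div 2 ^ x = 2 * q + 1" by (elim oddE)
    have n: "n = (2 * q + 1) * 2 ^ x + n mod 2 ^ x" by (metis q div_mult_mod_eq)
    have "q \<le> n div 2 ^ x" using q by simp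
    then have "q \<le> n" using div_le_dividend le_trans by blast
    then show "\<exists>q\<le>n. \<exists>r<2^x. n = (2 * q + 1) * 2 ^ x + r"
      using n by (intro exI[of _ q] conjI exI[of _ "n mod 2 ^ x"]) auto
  next
    assume "\<exists>q\<le>n. \<exists>r<2^x. n = (2 * q + 1) * 2 ^ x + r"
    then obtain q r where "r < 2 ^ x" "n = (2 * q + 1) * 2 ^ x + r" by blast
    then have "n div 2 ^ x = 2 * q + 1" by (intro div_nat_eqI) (auto simp: algebra_simps)
    then show "x \<in> set_decode n" by (simp add: set_decode_def)
  qed
  have "decp A (\<lambda>p. pi1 p \<in> set_decode (pi2 p))"
    unfolding * by (intro comp_intros)
  from decp_comp[OF this compf_pe[OF f g]] show ?thesis by simp
qed

lemma compf_Least [comp_intros]: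
  assumes P: "decp A (\<lambda>p. P (pi1 p) (pi2 p))" and ex: "\<And>e. \<exists>k. P e k"
  shows "compf A (\<lambda>e. LEAST k. P e k)"
proof -
  have "compf A (\<lambda>p. if P (pi1 p) (pi2 p) then 0 else 1)"
    by (intro comp_intros P)
  then obtain c where c: "\<And>p. evals A c p (if P (pi1 p) (pi2 p) then 0 else 1)"
    by (auto simp: compf_def)
  have "evals A (Minimize c) x (LEAST k. P x k)" for x
  proof (rule evals.Minimize)
    show "evals A c (pe x (LEAST k. P x k)) 0"
      using c[of "pe x (LEAST k. P x k)"] LeastI_ex[OF ex[of x]] by simp
    show "\<forall>k<LEAST k. P x k. \<exists>v. evals A c (pe x k) (Suc v)"
    proof (intro allI impI)
      fix k assume "k < (LEAST k. P x k)"
      then have "\<not> P x k" by (rule not_less_Least)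
      then show "\<exists>v. evals A c (pe x k) (Suc v)" using c[of "pe x k"] by auto
    qed
  qed
  then show ?thesis by (auto simp: compf_def)
qed

section \<open>Changing the oracle\<close>

primrec subst_query :: "code \<Rightarrow> code \<Rightarrow> code" where
  "subst_query q Zero = Zero"
| "subst_query q Succ = Succ"
| "subst_query q Fst = Fst"
| "subst_query q Snd = Snd"
| "subst_query q Query = q"
| "subst_query q (Pairing c d) = Pairing (subst_query q c) (subst_query q d)"
| "subst_query q (Compose c d) = Compose (subst_query q c) (subst_query q d)"
| "subst_query q (PrimRec c d) = PrimRec (subst_query q c) (subst_query q d)"
| "subst_query q (Minimize c) = Minimize (subst_query q c)"

lemma evals_subst_query:
  assumes "\<And>x. evals A q x (char_fun B x)" "evals B c x y"
  shows "evals A (subst_query q c) x y"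
  using assms(2)
proof induction
  case (Minimize c x y)
  then show ?case by (auto intro!: evals.Minimize)
qed (auto intro: evals.intros assms(1))

lemma compf_mono: "B \<le>\<^sub>T A \<Longrightarrow> compf B f \<Longrightarrow> compf A f"
  unfolding compf_def turing_le_def computes_def using evals_subst_query by meson

lemma decp_mono: "B \<le>\<^sub>T A \<Longrightarrow> decp B P \<Longrightarrow> decp A P"
  unfolding decp_def by (rule compf_mono)

lemma turing_le_trans: "B \<le>\<^sub>T C \<Longrightarrow> A \<le>\<^sub>T B \<Longrightarrow> A \<le>\<^sub>T C"
  using decp_mono turing_le_decp by blast

lemma decp_oracle: "decp A (\<lambda>x. x \<in> A)"
  unfolding decp_def compf_def using evals.Query[of A] by (metis char_fun_def)

lemma turing_le_refl: "A \<le>\<^sub>T A"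
  by (simp add: turing_le_decp decp_oracle)

lemma decp_mem: "B \<le>\<^sub>T A \<Longrightarrow> compf A f \<Longrightarrow> decp A (\<lambda>x. f x \<in> B)"
  using decp_comp turing_le_decp by blast

lemma empty_turing_le: "{} \<le>\<^sub>T A"
  by (simp add: turing_le_decp decp_const)

lemma turing_le_join: "A \<le>\<^sub>T A \<oplus>\<^sub>T B" "B \<le>\<^sub>T A \<oplus>\<^sub>T B"
proof -
  have *: "x \<in> A \<longleftrightarrow> 2 * x \<in> A \<oplus>\<^sub>T B" "x \<in> B \<longleftrightarrow> Suc (2 * x) \<in> A \<oplus>\<^sub>T B" for x
    unfolding turing_join_def by (auto; presburger)+
  show "A \<le>\<^sub>T A \<oplus>\<^sub>T B" unfolding turing_le_decp
    by (subst *(1)) (intro decp_mem comp_intros turing_le_refl)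
  show "B \<le>\<^sub>T A \<oplus>\<^sub>T B" unfolding turing_le_decp
    by (subst *(2)) (intro decp_mem comp_intros turing_le_refl)
qed

text \<open>Post's theorem: a search for a witness of either kind always ends, and testing which
  kind was found decides membership.\<close>

lemma decp_of_Sigma1:
  assumes P: "decp A (\<lambda>p. P (pi1 p) (pi2 p))" and Q: "decp A (\<lambda>p. Q (pi1 p) (pi2 p))"
    and in_S: "\<And>x. S x \<longleftrightarrow> (\<exists>y. P x y)" and out_S: "\<And>x. \<not> S x \<longleftrightarrow> (\<exists>y. Q x y)"
  shows "decp A S"
proof -
  define m where "m x = (LEAST y. P x y \<or> Q x y)" for x
  have ex: "\<exists>y. P x y \<or> Q x y" for x using in_S out_S by blast
  have m: "compf A m" unfolding m_def by (intro compf_Least comp_intros P Q ex)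
  have "S x \<longleftrightarrow> P x (m x)" for x
    using LeastI_ex[OF ex[of x]] in_S out_S unfolding m_def by blast
  then have "S = (\<lambda>x. P x (m x))" by blast
  then show ?thesis
    using decp_comp[OF P compf_pe[OF compf_id m]] by simp
qed

section \<open>Bounded evaluation\<close>

text \<open>
  A finite set of quadruples \<open>(r, e, x, y)\<close> is a derivation if each claim \<open>e(x) = y\<close> follows by an
  evaluation rule from claims of smaller rank \<open>r\<close>. Unlike lists of claims, such sets are closed
  under union.
\<close>

definition entry_below :: "nat set \<Rightarrow> nat \<Rightarrow> nat \<Rightarrow> nat \<Rightarrow> nat \<Rightarrow> bool" where
  "entry_below W r e x y \<longleftrightarrow> (\<exists>r'<r. pe r' (pe e (pe x y)) \<in> W)"

text \<open>The clauses follow the tags of \<open>encode_code\<close>. The number k is always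
  smaller than its tagged value, so \<open>k<e\<close> costs nothing and keeps the quantifier
  bounded. Ranks rather than sizes of programs make derivations well founded, since unfolding a
  recursion refers to the same program again.\<close>

definition justified :: "nat set \<Rightarrow> nat set \<Rightarrow> nat \<Rightarrow> nat \<Rightarrow> nat \<Rightarrow> nat \<Rightarrow> bool" where
  "justified A W r e x y \<longleftrightarrow>
     e = 0 \<and> y = 0 \<or> e = 1 \<and> y = Suc x \<or> e = 2 \<and> y = pi1 x \<or> e = 3 \<and> y = pi2 x \<or>
     e = 4 \<and> y = (if x \<in> A then 1 else 0) \<or>
     (\<exists>k<e. e = 5 + 4 * k \<and> entry_below W r (pi1 k) x (pi1 y) \<and> entry_below W r (pi2 k) x (pi2 y)) \<or>
     (\<exists>k<e. e = 6 + 4 * k \<and> (\<exists>z. entry_below W r (pi2 k) x z \<and> entry_below W r (pi1 k) z y)) \<or>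
     (\<exists>k<e. e = 7 + 4 * k \<and> pi2 x = 0 \<and> entry_below W r (pi1 k) (pi1 x) y) \<or>
     (\<exists>k<e. e = 7 + 4 * k \<and> pi2 x \<noteq> 0 \<and>
        (\<exists>z. entry_below W r e (pe (pi1 x) (pi2 x - 1)) z \<and>
          entry_below W r (pi2 k) (pe (pi1 x) (pe (pi2 x - 1) z)) y)) \<or>
     (\<exists>k<e. e = 8 + 4 * k \<and> entry_below W r k (pe x y) 0 \<and>
        (\<forall>j<y. \<exists>z. entry_below W r k (pe x j) (Suc z)))"

definition derivation :: "nat set \<Rightarrow> nat set \<Rightarrow> bool" where
  "derivation A W \<longleftrightarrow>
     (\<forall>z\<in>W. justified A W (pi1 z) (pi1 (pi2 z)) (pi1 (pi2 (pi2 z))) (pi2 (pi2 (pi2 z))))"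

text \<open>A finite set closed in this way acts as a parse tree: components are smaller numbers, so
  by descent each member codes a program.\<close>

definition code_set :: "nat set \<Rightarrow> bool" where
  "code_set K \<longleftrightarrow> (\<forall>e\<in>K. e < 5 \<or>
     (\<exists>k<e. (e = 5 + 4 * k \<or> e = 6 + 4 * k \<or> e = 7 + 4 * k) \<and> pi1 k \<in> K \<and> pi2 k \<in> K) \<or>
     (\<exists>k<e. e = 8 + 4 * k \<and> k \<in> K))"

lemma tag_distinct:
  fixes j k :: nat
  shows "5 + 4 * j = 6 + 4 * k \<longleftrightarrow> False" "5 + 4 * j = 7 + 4 * k \<longleftrightarrow> False" "5 + 4 * j = 8 + 4 * k \<longleftrightarrow> False"
    "6 + 4 * j = 5 + 4 * k \<longleftrightarrow> False" "6 + 4 * j = 7 + 4 * k \<longleftrightarrow> False" "6 + 4 * j = 8 + 4 * k \<longleftrightarrow> False"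
    "7 + 4 * j = 5 + 4 * k \<longleftrightarrow> False" "7 + 4 * j = 6 + 4 * k \<longleftrightarrow> False" "7 + 4 * j = 8 + 4 * k \<longleftrightarrow> False"
    "8 + 4 * j = 5 + 4 * k \<longleftrightarrow> False" "8 + 4 * j = 6 + 4 * k \<longleftrightarrow> False" "8 + 4 * j = 7 + 4 * k \<longleftrightarrow> False"
  by presburger+

lemma justified_simps:
  "justified A W r (encode_code Zero) x y \<longleftrightarrow> y = 0"
  "justified A W r (encode_code Succ) x y \<longleftrightarrow> y = Suc x"
  "justified A W r (encode_code Fst) x y \<longleftrightarrow> y = pi1 x"
  "justified A W r (encode_code Snd) x y \<longleftrightarrow> y = pi2 x"
  "justified A W r (encode_code Query) x y \<longleftrightarrow> y = char_fun A x"
  "justified A W r (encode_code (Pairing c d)) x y \<longleftrightarrow>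
     entry_below W r (encode_code c) x (pi1 y) \<and> entry_below W r (encode_code d) x (pi2 y)"
  "justified A W r (encode_code (Compose c d)) x y \<longleftrightarrow>
     (\<exists>z. entry_below W r (encode_code d) x z \<and> entry_below W r (encode_code c) z y)"
  "justified A W r (encode_code (PrimRec c d)) x y \<longleftrightarrow>
     (if pi2 x = 0 then entry_below W r (encode_code c) (pi1 x) y
      else \<exists>z. entry_below W r (encode_code (PrimRec c d)) (pe (pi1 x) (pi2 x - 1)) z \<and>
        entry_below W r (encode_code d) (pe (pi1 x) (pe (pi2 x - 1) z)) y)"
  "justified A W r (encode_code (Minimize c)) x y \<longleftrightarrow>
     entry_below W r (encode_code c) (pe x y) 0 \<and>
     (\<forall>j<y. \<exists>z. entry_below W r (encode_code c) (pe x j) (Suc z))"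
  unfolding justified_def encode_code.simps tag_distinct char_fun_def by auto

lemma derivation_sound:
  assumes "derivation A W"
  shows "entry_below W r (encode_code c) x y \<Longrightarrow> evals A c x y"
proof (induction r arbitrary: c x y rule: less_induct)
  case (less r)
  obtain r' where "r' < r" "pe r' (pe (encode_code c) (pe x y)) \<in> W"
    using less.prems by (auto simp: entry_below_def)
  then have j: "justified A W r' (encode_code c) x y"
    using assms by (force simp: derivation_def)
  note IH = less.IH[OF \<open>r' < r\<close>]
  show ?case
  proof (cases c)
    case Fst
    then show ?thesis using j evals.Fst[of A "pi1 x" "pi2 x"] by (simp only: justified_simps pi_pe)
  next
    case Snd
    then show ?thesis using j evals.Snd[of A "pi1 x" "pi2 x"] by (simp only: justified_simps pi_pe)
  next
    case (Pairing d1 d2)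
    then show ?thesis using j IH
      by (metis justified_simps(6) evals.Pairing pi_pe(3))
  next
    case (Compose d1 d2)
    then show ?thesis using j IH by (metis justified_simps(7) evals.Compose)
  next
    case (PrimRec d1 d2)
    show ?thesis
    proof (cases "pi2 x = 0")
      case True
      then show ?thesis
        using j IH evals.PrimRec_0[of A d1 "pi1 x" y d2] PrimRec by (metis justified_simps(8) pi_pe(3))
    next
      case False
      then obtain z where "evals A c (pe (pi1 x) (pi2 x - 1)) z"
        "evals A d2 (pe (pi1 x) (pe (pi2 x - 1) z)) y"
        using j IH PrimRec by (metis justified_simps(8))
      then show ?thesis using False evals.PrimRec_Suc[of A d1 d2 "pi1 x" "pi2 x - 1" z y] PrimRec
        by (metis Suc_pred neq0_conv pi_pe(3) One_nat_def)
    qed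
  next
    case (Minimize d)
    then show ?thesis using j IH by (metis justified_simps(9) evals.Minimize)
  qed (use j in \<open>auto simp only: justified_simps intro: evals.intros\<close>)
qed

lemma entry_below_mono:
  "entry_below W r e x y \<Longrightarrow> W \<subseteq> W' \<Longrightarrow> r \<le> r' \<Longrightarrow> entry_below W' r' e x y"
  unfolding entry_below_def by (meson less_le_trans subsetD)

lemma justified_mono:
  assumes "justified A W r e x y" and W: "W \<subseteq> W'"
  shows "justified A W' r e x y"
  using assms(1) unfolding justified_def
  by (elim disj_forward ex_forward conj_forward all_forward imp_forward)
    (assumption | erule entry_below_mono[OF _ W order_refl])+

lemma derivation_Union: "(\<And>W. W \<in> \<W> \<Longrightarrow> derivation A W) \<Longrightarrow> derivation A (\<Union>\<W>)"
  unfolding derivation_def using justified_mono by (metis Union_iff Union_upper)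

definition derivable :: "nat set \<Rightarrow> nat \<Rightarrow> nat \<Rightarrow> nat \<Rightarrow> bool" where
  "derivable A e x y \<longleftrightarrow> (\<exists>W r. finite W \<and> derivation A W \<and> entry_below W r e x y)"

text \<open>Derivations of the premises are merged by union, and the sum of their rank bounds
  exceeds every rank used for a premise, so it can serve as the rank of the new claim. Premises form
  an arbitrary finite set because minimization with value y has y + 1 of them.\<close>

lemma derivable_step:
  assumes J: "finite J" "\<And>e x y. (e, x, y) \<in> J \<Longrightarrow> derivable A e x y"
    and just: "\<And>W r. (\<And>e x y. (e, x, y) \<in> J \<Longrightarrow> entry_below W r e x y) \<Longrightarrow> justified A W r e0 x0 y0"
  shows "derivable A e0 x0 y0"
proof -
  have "\<forall>j\<in>J. \<exists>W r. finite W \<and> derivation A W \<and> entry_below W r (fst j) (fst (snd j)) (snd (snd j))"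
    using J(2) by (auto simp: derivable_def)
  then obtain W r where W: "\<And>j. j \<in> J \<Longrightarrow> finite (W j)" "\<And>j. j \<in> J \<Longrightarrow> derivation A (W j)"
    "\<And>j. j \<in> J \<Longrightarrow> entry_below (W j) (r j) (fst j) (fst (snd j)) (snd (snd j))"
    by metis
  define W0 where "W0 = (\<Union>j\<in>J. W j)"
  define r0 where "r0 = (\<Sum>j\<in>J. r j)"
  have "entry_below W0 r0 e x y" if "(e, x, y) \<in> J" for e x y
    using entry_below_mono[OF W(3)[OF that], of W0 r0] that J(1)
    by (auto simp: W0_def r0_def intro: member_le_sum)
  then have j: "justified A W0 r0 e0 x0 y0" by (rule just)
  have d: "derivation A W0" unfolding W0_def by (rule derivation_Union) (use W(2) in auto)
  let ?z = "pe r0 (pe e0 (pe x0 y0))"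
  have "derivation A (insert ?z W0)"
    using d j justified_mono[OF _ subset_insertI] unfolding derivation_def by (metis insertE pi_pe(1,2))
  moreover have "finite (insert ?z W0)" using W(1) J(1) by (auto simp: W0_def)
  moreover have "entry_below (insert ?z W0) (Suc r0) e0 x0 y0" by (auto simp: entry_below_def)
  ultimately show ?thesis unfolding derivable_def by blast
qed

lemma derivable_step2:
  assumes "derivable A e1 x1 y1" "derivable A e2 x2 y2"
    and "\<And>W r. entry_below W r e1 x1 y1 \<Longrightarrow> entry_below W r e2 x2 y2 \<Longrightarrow> justified A W r e0 x0 y0"
  shows "derivable A e0 x0 y0"
proof (rule derivable_step[of "{(e1, x1, y1), (e2, x2, y2)}"])
  fix W r
  assume "\<And>e x y. (e, x, y) \<in> {(e1, x1, y1), (e2, x2, y2)} \<Longrightarrow> entry_below W r e x y"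
  then show "justified A W r e0 x0 y0" by (intro assms(3)) simp_all
qed (use assms(1,2) in auto)

lemma evals_derivable: "evals A c x y \<Longrightarrow> derivable A (encode_code c) x y"
proof (induction rule: evals.induct)
  case (Pairing c x y d z)
  show ?case by (rule derivable_step2[OF Pairing.IH]) (simp only: justified_simps pi_pe)
next
  case (Compose d x y c z)
  show ?case by (rule derivable_step2[OF Compose.IH]) (unfold justified_simps, blast)
next
  case (PrimRec_0 c x y d)
  show ?case by (rule derivable_step2[OF PrimRec_0.IH PrimRec_0.IH]) (unfold justified_simps, simp)
next
  case (PrimRec_Suc c d x k y z)
  show ?case
    by (rule derivable_step2[OF PrimRec_Suc.IH])
      (simp only: justified_simps pi_pe nat.simps if_False diff_Suc_1, blast)
next
  case (Minimize c x y)
  from Minimize.IH(2) obtain v where v: "\<And>k. k < y \<Longrightarrow> derivable A (encode_code c) (pe x k) (Suc (v k))"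
    by metis
  show ?case
  proof (rule derivable_step)
    show "finite (insert (encode_code c, pe x y, 0) ((\<lambda>k. (encode_code c, pe x k, Suc (v k))) ` {..<y}))"
      (is "finite ?J") by simp
    show "derivable A e x' y'" if "(e, x', y') \<in> ?J" for e x' y'
      using that v Minimize.IH(1) by auto
    show "justified A W r (encode_code (Minimize c)) x y"
      if "\<And>e x y. (e, x, y) \<in> ?J \<Longrightarrow> entry_below W r e x y" for W r
      unfolding justified_simps using that by blast
  qed
qed (rule derivable_step[of "{}"], simp, simp, simp only: justified_simps pi_pe)+

lemma code_set_sound: "code_set K \<Longrightarrow> e \<in> K \<Longrightarrow> \<exists>c. encode_code c = e"
proof (induction e rule: less_induct)
  case (less e)
  consider "e < 5"
    | k where "e = 5 + 4 * k \<or> e = 6 + 4 * k \<or> e = 7 + 4 * k" "pi1 k \<in> K" "pi2 k \<in> K"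
    | k where "e = 8 + 4 * k" "k \<in> K"
    using less.prems unfolding code_set_def by blast
  then show ?case
  proof cases
    case 1
    then have "e = 0 \<or> e = 1 \<or> e = 2 \<or> e = 3 \<or> e = 4" by auto
    then show ?thesis by (metis encode_code.simps(1-5))
  next
    case (2 k)
    have "pi1 k \<le> k" "pi2 k \<le> k"
      by (metis le_prod_encode_1 pi_pe(3), metis le_prod_encode_2 pi_pe(3))
    then have "pi1 k < e" "pi2 k < e" using 2(1) by auto
    then obtain c d where "encode_code c = pi1 k" "encode_code d = pi2 k"
      using less.IH less.prems(1) 2 by blast
    then show ?thesis using 2(1) encode_code.simps(6-8)[of c d] by (metis pi_pe(3))
  next
    case (3 k)
    then have "k < e" by simp
    then show ?thesis using less.IH less.prems(1) 3 encode_code.simps(9) by metis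
  qed
qed

lemma code_set_complete: "\<exists>K. finite K \<and> code_set K \<and> encode_code c \<in> K"
proof -
  have un: "code_set (K \<union> L)" if "code_set K" "code_set L" for K L
    using that unfolding code_set_def by blast
  have ins2: "code_set (insert e K)"
    if "code_set K" "pi1 k \<in> K" "pi2 k \<in> K" "e = 5 + 4 * k \<or> e = 6 + 4 * k \<or> e = 7 + 4 * k" for e k K
  proof -
    have "k < e" using that(4) by auto
    then show ?thesis using that unfolding code_set_def by blast
  qed
  have ins1: "code_set (insert e K)" if "code_set K" "k \<in> K" "e = 8 + 4 * k" for e k K
  proof -
    have "k < e" using that(3) by auto
    then show ?thesis using that unfolding code_set_def by blast
  qed
  have base: "?thesis" if "encode_code c < 5"
    using that by (intro exI[of _ "{encode_code c}"]) (auto simp: code_set_def)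
  have pair: "\<exists>K. finite K \<and> code_set K \<and> e \<in> K"
    if "e = 5 + 4 * pe a b \<or> e = 6 + 4 * pe a b \<or> e = 7 + 4 * pe a b"
      "\<exists>K. finite K \<and> code_set K \<and> a \<in> K" "\<exists>K. finite K \<and> code_set K \<and> b \<in> K" for e a b
  proof -
    from that(2,3) obtain K L where "finite K" "code_set K" "a \<in> K" "finite L" "code_set L" "b \<in> L"
      by blast
    then show ?thesis using that(1) ins2[OF un, of K L "pe a b" e]
      by (intro exI[of _ "insert e (K \<union> L)"]) simp
  qed
  show ?thesis
  proof (induction c)
    case (Minimize c)
    then obtain K where K: "finite K" "code_set K" "encode_code c \<in> K" by blast
    show ?case using K ins1[OF K(2,3) refl]
      by (intro exI[of _ "insert (8 + 4 * encode_code c) K"]) simp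
  next
    case Zero show ?case by (intro exI[of _ "{0}"]) (auto simp: code_set_def)
  next
    case Succ show ?case by (intro exI[of _ "{1}"]) (auto simp: code_set_def)
  next
    case Fst show ?case by (intro exI[of _ "{2}"]) (auto simp: code_set_def)
  next
    case Snd show ?case by (intro exI[of _ "{3}"]) (auto simp: code_set_def)
  next
    case Query show ?case by (intro exI[of _ "{4}"]) (auto simp: code_set_def)
  qed (simp only: encode_code.simps; rule pair; blast)+
qed

text \<open>
  The second conjunct is not redundant: recursion from 0 never evaluates the step program, which
  therefore need not be the code of a program in a derivation.
\<close>

definition conv :: "nat set \<Rightarrow> nat \<Rightarrow> nat \<Rightarrow> nat \<Rightarrow> nat \<Rightarrow> bool" where
  "conv A e x y t \<longleftrightarrow>
     (\<exists>w<t. derivation A (set_decode w) \<and> entry_below (set_decode w) w e x y) \<and>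
     (\<exists>w<t. code_set (set_decode w) \<and> e \<in> set_decode w)"

lemma conv_mono: "conv A e x y t \<Longrightarrow> t \<le> t' \<Longrightarrow> conv A e x y t'"
  unfolding conv_def by (meson less_le_trans)

lemma entry_less:
  assumes "pe r (pe e (pe x y)) \<in> set_decode w"
  shows "r < w" "y < w"
proof -
  have "pe r (pe e (pe x y)) < w" using assms by (rule set_decode_less)
  then show "r < w" "y < w"
    by (meson le_prod_encode_1 le_prod_encode_2 le_less_trans)+
qed

lemma conv_iff: "(\<exists>t. conv A e x y t) \<longleftrightarrow> (\<exists>c. encode_code c = e \<and> evals A c x y)"
proof
  assume "\<exists>t. conv A e x y t"
  then show "\<exists>c. encode_code c = e \<and> evals A c x y"
    unfolding conv_def using code_set_sound derivation_sound by metis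
next
  assume "\<exists>c. encode_code c = e \<and> evals A c x y"
  then obtain c where c: "encode_code c = e" "evals A c x y" by blast
  obtain W r where W: "finite W" "derivation A W" "entry_below W r e x y"
    using evals_derivable[OF c(2)] c(1) by (auto simp: derivable_def)
  obtain K where K: "finite K" "code_set K" "e \<in> K" using code_set_complete c(1) by blast
  \<comment> \<open>The code of W is itself a large enough rank bound, because every rank occurring
    in W is smaller than that code.\<close>
  have "entry_below (set_decode (set_encode W)) (set_encode W) e x y"
    using W(1,3) entry_less(1)[of _ e x y "set_encode W"] by (auto simp: entry_below_def)
  then have "conv A e x y (Suc (set_encode W + set_encode K))"
    unfolding conv_def using W K
    by (intro conjI exI[of _ "set_encode W"] exI[of _ "set_encode K"]) auto
  then show "\<exists>t. conv A e x y t" ..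
qed

text \<open>Values occurring in a coded set are below its code. This bounds the quantifiers over
  intermediate values in \<open>justified\<close>, which makes being a derivation decidable.\<close>

lemma entry_below_bound:
  "(\<exists>z. entry_below (set_decode w) r e x z \<and> P z) \<longleftrightarrow> (\<exists>z<w. entry_below (set_decode w) r e x z \<and> P z)"
  "(\<exists>z. entry_below (set_decode w) r e x (Suc z)) \<longleftrightarrow> (\<exists>z<w. entry_below (set_decode w) r e x (Suc z))"
  unfolding entry_below_def using entry_less(2) Suc_lessD by blast+

lemma Ball_set_decode: "(\<forall>z\<in>set_decode w. P z) \<longleftrightarrow> (\<forall>z<w. z \<in> set_decode w \<longrightarrow> P z)"
  using set_decode_less by blast

lemma decp_conv:
  assumes "B \<le>\<^sub>T A" "compf A e" "compf A x" "compf A y" "compf A t"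
  shows "decp A (\<lambda>p. conv B (e p) (x p) (y p) (t p))"
proof -
  have deriv: "decp A (\<lambda>p. derivation B (set_decode p))"
    unfolding derivation_def justified_def entry_below_bound Ball_set_decode
    unfolding entry_below_def
    by (intro comp_intros decp_mem[OF assms(1)])
  have code: "decp A (\<lambda>p. code_set (set_decode p))"
    unfolding code_set_def Ball_set_decode by (intro comp_intros)
  show ?thesis
    unfolding conv_def entry_below_def
    by (intro comp_intros decp_comp[OF deriv] decp_comp[OF code] compf_comp[OF assms(2)]
        compf_comp[OF assms(3)] compf_comp[OF assms(4)] assms)
qed

section \<open>The arithmetical hierarchy\<close>

lemma Sigma0_SucI:
  assumes "P \<in> Sigma0 n A" "\<And>x. x \<in> S \<longleftrightarrow> (\<exists>y. pe x y \<notin> P)"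
  shows "S \<in> Sigma0 (Suc n) A"
proof -
  have "S = {x. \<exists>y. pe x y \<notin> P}" using assms(2) by blast
  then show ?thesis using assms(1) by auto
qed

lemma Sigma0_SucE:
  assumes "S \<in> Sigma0 (Suc n) A"
  obtains P where "P \<in> Sigma0 n A" "\<And>x. x \<in> S \<longleftrightarrow> (\<exists>y. pe x y \<notin> P)"
  using assms by auto

lemma Sigma0_preimage: "S \<in> Sigma0 n A \<Longrightarrow> compf A f \<Longrightarrow> {x. f x \<in> S} \<in> Sigma0 n A"
proof (induction n arbitrary: S f)
  case 0
  then show ?case by (auto simp: turing_le_decp intro: decp_comp)
next
  case (Suc n)
  from Suc.prems(1) obtain P where P: "P \<in> Sigma0 n A" "\<And>x. x \<in> S \<longleftrightarrow> (\<exists>y. pe x y \<notin> P)"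
    by (rule Sigma0_SucE) blast
  have "compf A (\<lambda>p. pe (f (pi1 p)) (pi2 p))"
    by (intro comp_intros compf_comp[OF Suc.prems(2)])
  from Suc.IH[OF P(1) this] show ?case
    by (rule Sigma0_SucI) (simp add: P(2))
qed

text \<open>The two closure properties are proved together because levels alternate with
  complements: an intersection at one level comes from a union at the level below, and
  conversely.\<close>

lemma Sigma0_Int_Un:
  "S \<in> Sigma0 n A \<Longrightarrow> R \<in> Sigma0 n A \<Longrightarrow> S \<inter> R \<in> Sigma0 n A \<and> S \<union> R \<in> Sigma0 n A"
proof (induction n arbitrary: S R)
  case 0
  then show ?case by (auto simp: turing_le_decp intro: decp_conj decp_disj)
next
  case (Suc n)
  from Suc.prems(1) obtain P where P: "P \<in> Sigma0 n A" "\<And>x. x \<in> S \<longleftrightarrow> (\<exists>y. pe x y \<notin> P)"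
    by (rule Sigma0_SucE) blast
  from Suc.prems(2) obtain Q where Q: "Q \<in> Sigma0 n A" "\<And>x. x \<in> R \<longleftrightarrow> (\<exists>y. pe x y \<notin> Q)"
    by (rule Sigma0_SucE) blast
  have "S \<union> R \<in> Sigma0 (Suc n) A"
    by (rule Sigma0_SucI[of "P \<inter> Q"]) (use Suc.IH[OF P(1) Q(1)] P(2) Q(2) in auto)
  moreover
  let ?P = "{p. pe (pi1 p) (pi1 (pi2 p)) \<in> P}" and ?Q = "{p. pe (pi1 p) (pi2 (pi2 p)) \<in> Q}"
  have "?P \<in> Sigma0 n A" "?Q \<in> Sigma0 n A"
    by (intro Sigma0_preimage P(1) Q(1) comp_intros)+
  then have "?P \<union> ?Q \<in> Sigma0 n A" using Suc.IH by blast
  then have "S \<inter> R \<in> Sigma0 (Suc n) A"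
  proof (rule Sigma0_SucI)
    fix x
    show "x \<in> S \<inter> R \<longleftrightarrow> (\<exists>y. pe x y \<notin> ?P \<union> ?Q)"
    proof
      assume "x \<in> S \<inter> R"
      then obtain y z where "pe x y \<notin> P" "pe x z \<notin> Q" using P(2) Q(2) by blast
      then have "pe x (pe y z) \<notin> ?P \<union> ?Q" by simp
      then show "\<exists>y. pe x y \<notin> ?P \<union> ?Q" ..
    qed (use P(2) Q(2) in auto)
  qed
  ultimately show ?case by simp
qed

lemmas Sigma0_Int = Sigma0_Int_Un[THEN conjunct1]

lemma Sigma0_Suc_mono: "Sigma0 n A \<subseteq> Sigma0 (Suc n) A"
proof (induction n)
  case 0
  show ?case
  proof
    fix S assume "S \<in> Sigma0 0 A"
    then have "decp A (\<lambda>x. x \<in> S)" by (simp add: turing_le_decp)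
    from decp_not[OF decp_comp[OF this compf_pi1_id]]
    have "{p. pi1 p \<notin> S} \<in> Sigma0 0 A" by (simp add: turing_le_decp)
    then show "S \<in> Sigma0 (Suc 0) A" by (rule Sigma0_SucI) simp
  qed
next
  case (Suc n)
  then show ?case by (metis Sigma0_SucE Sigma0_SucI subsetD subsetI)
qed

lemma Sigma0_mono: "m \<le> n \<Longrightarrow> S \<in> Sigma0 m A \<Longrightarrow> S \<in> Sigma0 n A"
  using lift_Suc_mono_le[of "\<lambda>n. Sigma0 n A", OF Sigma0_Suc_mono] by blast

lemma Sigma0_oracle_mono: "B \<le>\<^sub>T A \<Longrightarrow> S \<in> Sigma0 n B \<Longrightarrow> S \<in> Sigma0 n A"
proof (induction n arbitrary: S)
  case 0
  then show ?case using turing_le_trans by auto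
next
  case (Suc n)
  then show ?case by (metis Sigma0_SucE Sigma0_SucI)
qed

text \<open>A Pi_2 predicate becomes Sigma_3 through a vacuous outer quantifier. Totality and
  infinity of a reservoir have this form, which is where the bound 3 comes from.\<close>

lemma Sigma0_3_all_ex:
  assumes "decp A (\<lambda>p. R (pi1 p) (pi1 (pi2 p)) (pi2 (pi2 p)))"
  shows "{x. \<forall>y. \<exists>z. R x y z} \<in> Sigma0 3 A"
proof -
  have "decp A (\<lambda>q. \<not> R (pi1 (pi1 (pi1 q))) (pi2 (pi1 q)) (pi2 q))"
    using decp_not[OF decp_comp[OF assms, of "\<lambda>q. pe (pi1 (pi1 (pi1 q))) (pe (pi2 (pi1 q)) (pi2 q))"]]
    by (simp add: comp_intros)
  then have "{q. \<not> R (pi1 (pi1 (pi1 q))) (pi2 (pi1 q)) (pi2 q)} \<in> Sigma0 0 A"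
    by (simp add: turing_le_decp)
  then have "{p. \<exists>z. R (pi1 (pi1 p)) (pi2 p) z} \<in> Sigma0 1 A"
    unfolding One_nat_def by (rule Sigma0_SucI) simp
  then have "{x. \<exists>y. \<forall>z. \<not> R (pi1 x) y z} \<in> Sigma0 (Suc 1) A"
    by (rule Sigma0_SucI) simp
  then have "{x. \<forall>y. \<exists>z. R x y z} \<in> Sigma0 (Suc (Suc 1)) A"
    by (rule Sigma0_SucI) simp
  then show ?thesis by (simp only: numeral_3_eq_3 One_nat_def)
qed

lemma computes_conv_iff:
  assumes "computes A e S"
  shows "(\<exists>t. conv A e x v t) \<longleftrightarrow> v = char_fun S x"
  using assms conv_iff[of A e x v] evals_deterministic inj_encode_code
  unfolding computes_def inj_def by metis

lemma computesI_conv: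
  assumes "\<And>x. \<exists>t. conv A e x (char_fun S x) t"
  shows "computes A e S"
  using assms inj_encode_code unfolding conv_iff computes_def inj_def by metis

lemma computes_mem: "computes A e S \<Longrightarrow> x \<in> S \<longleftrightarrow> (\<exists>t. conv A e x 1 t)"
  using computes_conv_iff[of A e S x 1] by (simp add: char_fun_def)

text \<open>Stages are monotone, so a single t can witness both computations. Totality, values below
  2 and agreement of the two programs thus become one Pi_2 statement.\<close>

lemma computes_pair_iff:
  "(\<forall>x. \<exists>t. \<exists>v<2. conv A0 e0 x v t \<and> conv A1 e1 x v t) \<longleftrightarrow>
   (\<exists>S. computes A0 e0 S \<and> computes A1 e1 S)"
proof
  assume *: "\<forall>x. \<exists>t. \<exists>v<2. conv A0 e0 x v t \<and> conv A1 e1 x v t"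
  then obtain f where f: "\<And>x. f x < 2 \<and> (\<exists>t. conv A0 e0 x (f x) t) \<and> (\<exists>t. conv A1 e1 x (f x) t)"
    by metis
  define S where "S = {x. f x = 1}"
  have "f x = char_fun S x" for x
    using f[of x] by (auto simp: S_def char_fun_def)
  then show "\<exists>S. computes A0 e0 S \<and> computes A1 e1 S"
    using f by (metis computesI_conv)
next
  assume "\<exists>S. computes A0 e0 S \<and> computes A1 e1 S"
  then obtain S where S: "computes A0 e0 S" "computes A1 e1 S" by blast
  show "\<forall>x. \<exists>t. \<exists>v<2. conv A0 e0 x v t \<and> conv A1 e1 x v t"
  proof
    fix x
    obtain t t' where "conv A0 e0 x (char_fun S x) t" "conv A1 e1 x (char_fun S x) t'"
      using computes_conv_iff[OF S(1)] computes_conv_iff[OF S(2)] by blast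
    then have "conv A0 e0 x (char_fun S x) (t + t')" "conv A1 e1 x (char_fun S x) (t + t')"
      by (auto elim: conv_mono)
    then show "\<exists>t. \<exists>v<2. conv A0 e0 x v t \<and> conv A1 e1 x v t"
      by (intro exI[of _ "t + t'"] exI[of _ "char_fun S x"]) (auto simp: char_fun_def)
  qed
qed

section \<open>Definable collections of conditions\<close>

text \<open>Being an index of an I-condition is a conjunction of Pi_2 requirements: both programs
  decide the same set, the set is infinite, and it lies above the finite part. A property of pairs
  from the reservoir that is decidable in the exact pair joins the last of these; a property of the
  finite part may have the full complexity Sigma_n. The collections to which genericity of G is
  applied have this shape.\<close>

lemma Sigma0_collectionI:
  assumes "exact_pair I A0 A1" "n \<ge> 3"
    and M: "decp (A0 \<oplus>\<^sub>T A1) (\<lambda>p. M (pi1 p) (pi1 (pi2 p)) (pi2 (pi2 p)))"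
    and N: "{h. N h} \<in> Sigma0 n (A0 \<oplus>\<^sub>T A1)"
    and K: "K = {(D, S). ideal_condition I (D, S) \<and>
       (\<forall>x\<in>S. \<forall>y\<in>S. x \<le> y \<longrightarrow> M (set_encode D) x y) \<and> N (set_encode D)}"
  shows "Sigma0_collection n I A0 A1 K"
proof -
  let ?A = "A0 \<oplus>\<^sub>T A1"
  note conv0 = decp_conv[OF turing_le_join(1)[of A0 A1]]
  note conv1 = decp_conv[OF turing_le_join(2)[of A1 A0]]
  define V1 where "V1 = {j. \<forall>x. \<exists>t. \<exists>v<2. conv A0 (pi1 (pi2 j)) x v t \<and> conv A1 (pi2 (pi2 j)) x v t}"
  define V2 where "V2 = {j. \<forall>x. \<exists>z. x < pi1 z \<and> conv A0 (pi1 (pi2 j)) (pi1 z) 1 (pi2 z)}"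
  \<comment> \<open>One stage serves both membership claims, which monotonicity of
    \<open>conv\<close> permits. The requirement is purely universal; the vacuous \<open>z\<close>
    gives it the form expected by \<open>Sigma0_3_all_ex\<close>.\<close>
  define V3 where "V3 = {j. \<forall>q. \<exists>z::nat.
     conv A0 (pi1 (pi2 j)) (pi1 q) 1 (pi2 (pi2 q)) \<longrightarrow>
     conv A0 (pi1 (pi2 j)) (pi1 (pi2 q)) 1 (pi2 (pi2 q)) \<longrightarrow>
     (\<forall>d<pi1 j. d \<in> set_decode (pi1 j) \<longrightarrow> d < pi1 q) \<and>
     (pi1 q \<le> pi1 (pi2 q) \<longrightarrow> M (pi1 j) (pi1 q) (pi1 (pi2 q)))}"
  have V1: "V1 \<in> Sigma0 3 ?A"
    unfolding V1_def by (rule Sigma0_3_all_ex) (intro comp_intros conv0 conv1)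
  have V2: "V2 \<in> Sigma0 3 ?A"
    unfolding V2_def by (rule Sigma0_3_all_ex) (intro comp_intros conv0)
  have "decp ?A (\<lambda>p. M (pi1 (pi1 p)) (pi1 (pi1 (pi2 p))) (pi1 (pi2 (pi1 (pi2 p)))))"
    using decp_comp[OF M, of "\<lambda>p. pe (pi1 (pi1 p)) (pe (pi1 (pi1 (pi2 p))) (pi1 (pi2 (pi1 (pi2 p)))))"]
    by (simp add: comp_intros)
  then have V3: "V3 \<in> Sigma0 3 ?A"
    unfolding V3_def by (intro Sigma0_3_all_ex comp_intros conv0)
  have V4: "{j. N (pi1 j)} \<in> Sigma0 n ?A"
    using Sigma0_preimage[OF N compf_pi1_id] by simp
  have "{j. \<exists>p\<in>K. condition_index A0 A1 j p} = V1 \<inter> V2 \<inter> V3 \<inter> {j. N (pi1 j)}"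
  proof (intro set_eqI iffI)
    fix j assume "j \<in> {j. \<exists>p\<in>K. condition_index A0 A1 j p}"
    then obtain D S e0 e1 where p: "(D, S) \<in> K" "j = pe (set_encode D) (pe e0 e1)"
      "computes A0 e0 S" "computes A1 e1 S"
      by (auto simp: condition_index_def)
    have fin: "finite D" and inf: "infinite S" and ord: "\<And>d s. d \<in> D \<Longrightarrow> s \<in> S \<Longrightarrow> d < s"
      and MN: "\<And>x y. x \<in> S \<Longrightarrow> y \<in> S \<Longrightarrow> x \<le> y \<Longrightarrow> M (set_encode D) x y" "N (set_encode D)"
      using p(1) by (auto simp: K ideal_condition_def mathias_condition_def)
    have S: "x \<in> S \<longleftrightarrow> (\<exists>t. conv A0 e0 x 1 t)" for x by (rule computes_mem[OF p(3)])
    have "j \<in> V1" using p(2-4) computes_pair_iff[of A0 e0 A1 e1] by (auto simp: V1_def)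
    moreover have "j \<in> V2"
    proof -
      have "\<exists>z. x < pi1 z \<and> conv A0 e0 (pi1 z) 1 (pi2 z)" for x
      proof -
        obtain y where "y \<in> S" "x < y" using inf by (meson infinite_nat_iff_unbounded)
        then obtain t where "conv A0 e0 y 1 t" using S by blast
        then show ?thesis using \<open>x < y\<close> by (intro exI[of _ "pe y t"]) simp
      qed
      then show ?thesis by (simp add: V2_def p(2))
    qed
    moreover have "j \<in> V3" unfolding V3_def p(2) mem_Collect_eq pi_pe
        set_encode_inverse[OF fin] using MN(1) ord S by blast
    ultimately show "j \<in> V1 \<inter> V2 \<inter> V3 \<inter> {j. N (pi1 j)}" using MN(2) p(2) by simp
  next
    fix j assume j: "j \<in> V1 \<inter> V2 \<inter> V3 \<inter> {j. N (pi1 j)}"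
    define D where "D = set_decode (pi1 j)"
    have D: "finite D" "set_encode D = pi1 j" by (simp_all add: D_def)
    from j obtain S where cS: "computes A0 (pi1 (pi2 j)) S" "computes A1 (pi2 (pi2 j)) S"
      using computes_pair_iff[of A0 "pi1 (pi2 j)" A1 "pi2 (pi2 j)"] by (auto simp: V1_def)
    have S: "x \<in> S \<longleftrightarrow> (\<exists>t. conv A0 (pi1 (pi2 j)) x 1 t)" for x by (rule computes_mem[OF cS(1)])
    have "\<exists>y\<in>S. x < y" for x
      using j S unfolding V2_def by blast
    then have inf: "infinite S" by (meson finite_nat_set_iff_bounded less_asym)
    have both: "(\<forall>d\<in>D. d < x) \<and> (x \<le> y \<longrightarrow> M (set_encode D) x y)" if xy: "x \<in> S" "y \<in> S" for x y
    proof -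
      obtain t t' where "conv A0 (pi1 (pi2 j)) x 1 t" "conv A0 (pi1 (pi2 j)) y 1 t'"
        using xy S by blast
      then have "conv A0 (pi1 (pi2 j)) x 1 (t + t')" "conv A0 (pi1 (pi2 j)) y 1 (t + t')"
        by (auto elim: conv_mono)
      moreover have "conv A0 (pi1 (pi2 j)) (pi1 (pe x (pe y (t + t')))) 1 (pi2 (pi2 (pe x (pe y (t + t'))))) \<longrightarrow>
         conv A0 (pi1 (pi2 j)) (pi1 (pi2 (pe x (pe y (t + t'))))) 1 (pi2 (pi2 (pe x (pe y (t + t'))))) \<longrightarrow>
         (\<forall>d<pi1 j. d \<in> set_decode (pi1 j) \<longrightarrow> d < pi1 (pe x (pe y (t + t')))) \<and>
         (pi1 (pe x (pe y (t + t'))) \<le> pi1 (pi2 (pe x (pe y (t + t')))) \<longrightarrow>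
           M (pi1 j) (pi1 (pe x (pe y (t + t')))) (pi1 (pi2 (pe x (pe y (t + t'))))))"
        using j unfolding V3_def by blast
      ultimately show ?thesis using set_decode_less by (simp add: D_def)
    qed
    have "S \<in> I" using assms(1) cS by (auto simp: exact_pair_def turing_le_def)
    then have "(D, S) \<in> K"
      using both inf D j by (auto simp: K ideal_condition_def mathias_condition_def)
    moreover have "condition_index A0 A1 j (D, S)"
      unfolding condition_index_def prod.case D(2)
      by (rule exI[of _ "pi1 (pi2 j)"], rule exI[of _ "pi2 (pi2 j)"]) (simp add: cS)
    ultimately show "j \<in> {j. \<exists>p\<in>K. condition_index A0 A1 j p}" by blast
  qed
  moreover have "V1 \<inter> V2 \<inter> V3 \<inter> {j. N (pi1 j)} \<in> Sigma0 n ?A"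
    using V1 V2 V3 V4 Sigma0_mono[OF assms(2)] by (intro Sigma0_Int) auto
  ultimately show ?thesis unfolding Sigma0_collection_def K by auto
qed

section \<open>Density arguments over an ideal\<close>

locale generic_set =
  fixes I :: "nat set set" and A0 A1 G :: "nat set" and n :: nat
  assumes ideal: "turing_ideal I" and exact: "exact_pair I A0 A1"
    and n: "n \<ge> 3" and generic: "mathias_generic n I A0 A1 G"
begin

lemma ideal_le: "S \<in> I \<Longrightarrow> R \<le>\<^sub>T S \<Longrightarrow> R \<in> I"
  using ideal by (auto simp: turing_ideal_def)

lemma ideal_decp: "S \<in> I \<Longrightarrow> decp S P \<Longrightarrow> {x. P x} \<in> I"
  by (rule ideal_le) (simp_all add: turing_le_decp)

lemma ideal_join: "S \<in> I \<Longrightarrow> R \<in> I \<Longrightarrow> S \<oplus>\<^sub>T R \<in> I"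
  using ideal by (auto simp: turing_ideal_def)

lemma ideal_computable: "R \<le>\<^sub>T {} \<Longrightarrow> R \<in> I"
  using ideal turing_le_trans[OF empty_turing_le] by (fastforce simp: turing_ideal_def)

lemma ideal_oracle: "S \<in> I \<Longrightarrow> S \<le>\<^sub>T A0 \<oplus>\<^sub>T A1"
  using exact turing_le_trans[OF turing_le_join(1)] by (auto simp: exact_pair_def)

text \<open>An avoiding condition would, by density, have an extension in the collection, so a
  generic set can only meet it.\<close>

lemma generic_meets_dense:
  assumes M: "decp (A0 \<oplus>\<^sub>T A1) (\<lambda>p. M (pi1 p) (pi1 (pi2 p)) (pi2 (pi2 p)))"
    and N: "{h. N h} \<in> Sigma0 n (A0 \<oplus>\<^sub>T A1)"
    and dense: "\<And>D S. ideal_condition I (D, S) \<Longrightarrow>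
      \<exists>D' S'. ideal_condition I (D', S') \<and> extends (D', S') (D, S) \<and>
        (\<forall>x\<in>S'. \<forall>y\<in>S'. x \<le> y \<longrightarrow> M (set_encode D') x y) \<and> N (set_encode D')"
  shows "\<exists>D S. ideal_condition I (D, S) \<and> satisfies G (D, S) \<and>
        (\<forall>x\<in>S. \<forall>y\<in>S. x \<le> y \<longrightarrow> M (set_encode D) x y) \<and> N (set_encode D)"
proof -
  define K where "K = {(D, S). ideal_condition I (D, S) \<and>
       (\<forall>x\<in>S. \<forall>y\<in>S. x \<le> y \<longrightarrow> M (set_encode D) x y) \<and> N (set_encode D)}"
  have "\<not> avoids I G K"
  proof
    assume "avoids I G K"
    then obtain D S where p: "ideal_condition I (D, S)" "\<not> (\<exists>q\<in>K. extends q (D, S))"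
      by (auto simp: avoids_def)
    from dense[OF p(1)] obtain D' S' where "extends (D', S') (D, S)" "(D', S') \<in> K"
      by (auto simp: K_def)
    then show False using p(2) by blast
  qed
  then have "meets G K"
    using generic Sigma0_collectionI[OF exact n M N K_def] unfolding mathias_generic_def by blast
  then show ?thesis by (auto simp: meets_def K_def)
qed

lemma condition_insert:
  assumes "ideal_condition I (D, S)" "y \<in> S"
  shows "ideal_condition I (insert y D, {z \<in> S. y < z})" "extends (insert y D, {z \<in> S. y < z}) (D, S)"
proof -
  have "infinite {z \<in> S. y < z}"
    using assms(1) by (auto simp: ideal_condition_def mathias_condition_def infinite_nat_iff_unbounded)
      (meson max_less_iff_conj)
  moreover have "{z \<in> S. y < z} \<in> I"
    using assms(1) by (intro ideal_decp[of S] comp_intros decp_oracle) (auto simp: ideal_condition_def)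
  ultimately show "ideal_condition I (insert y D, {z \<in> S. y < z})"
    using assms by (auto simp: ideal_condition_def mathias_condition_def)
  show "extends (insert y D, {z \<in> S. y < z}) (D, S)"
    using assms by (auto simp: extends_def)
qed

lemma condition_unbounded:
  assumes "ideal_condition I (D, S)"
  shows "\<exists>y\<in>S. y \<ge> m"
  using assms by (auto simp: ideal_condition_def mathias_condition_def infinite_nat_iff_unbounded_le)

text \<open>Greedy selection: \<open>last k\<close> is the last number kept before k, with
  \<open>q\<close> as starting value, and k is kept if it lies in S beyond \<open>last k\<close> and
  P holds of the two. Testing against the preceding element suffices for all earlier ones because P
  is monotone in its first argument. The selection is computable in the join of S and X, so the
  result stays in I. It is used for settling times and for the checks made by the decoder.\<close>

lemma thin:
  assumes S: "S \<in> I" "infinite S" and X: "X \<in> I" "decp X (\<lambda>p. P (pi1 p) (pi2 p))"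
    and mono: "\<And>x x' y. P x y \<Longrightarrow> x' \<le> x \<Longrightarrow> P x' y"
    and ev: "\<And>x. \<exists>t. \<forall>y\<ge>t. P x y"
  shows "\<exists>S'\<subseteq>S. infinite S' \<and> S' \<in> I \<and> (\<forall>y\<in>S'. q < y \<and> P q y) \<and> (\<forall>x\<in>S'. \<forall>y\<in>S'. x < y \<longrightarrow> P x y)"
proof -
  define pick where "pick l k \<longleftrightarrow> k \<in> S \<and> l < k \<and> P l k" for l k
  define last where "last k = rec_nat q (\<lambda>k l. if pick l k then k else l) k" for k
  have last_Suc: "last (Suc k) = (if pick (last k) k then k else last k)" for k
    by (simp add: last_def)
  have "last k \<le> last (Suc k)" for k by (simp add: last_Suc pick_def)
  then have mono_last: "k \<le> k' \<Longrightarrow> last k \<le> last k'" for k k' by (rule lift_Suc_mono_le)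
  have last_ge: "q \<le> last k" for k using mono_last[of 0 k] by (simp add: last_def)
  define S' where "S' = {k. pick (last k) k}"
  have "S' \<subseteq> S" by (auto simp: S'_def pick_def)
  moreover have "S' \<in> I"
  proof -
    let ?Z = "S \<oplus>\<^sub>T X"
    have "decp ?Z (\<lambda>p. P (pi1 p) (pi2 p))" by (rule decp_mono[OF turing_le_join(2) X(2)])
    then have pick: "decp ?Z (\<lambda>p. pick (pi1 p) (pi2 p))"
      unfolding pick_def by (intro comp_intros decp_mem[OF turing_le_join(1)])
    have "decp ?Z (\<lambda>p. pick (pi2 (pi2 p)) (pi1 (pi2 p)))"
      using decp_comp[OF pick, of "\<lambda>p. pe (pi2 (pi2 p)) (pi1 (pi2 p))"] by (simp add: comp_intros)
    then have "compf ?Z last" unfolding last_def by (intro comp_intros)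
    from decp_comp[OF pick compf_pe[OF this compf_id]]
    show ?thesis unfolding S'_def by (intro ideal_decp[OF ideal_join[OF S(1) X(1)]]) simp
  qed
  moreover have "infinite S'"
  proof
    assume "finite S'"
    then obtain N where N: "\<And>k. k \<in> S' \<Longrightarrow> k < N" by (auto simp: finite_nat_set_iff_bounded)
    have const: "last (N + k) = last N" for k
    proof (induction k)
      case (Suc k)
      have "N + k \<notin> S'" using N[of "N + k"] by auto
      then show ?case using Suc by (simp add: last_Suc S'_def)
    qed simp
    obtain t where t: "\<And>y. y \<ge> t \<Longrightarrow> P (last N) y" using ev by blast
    obtain y where "y \<in> S" "y \<ge> t + N + Suc (last N)"
      using S(2) by (meson infinite_nat_iff_unbounded_le)
    then have "pick (last y) y" using const[of "y - N"] t by (simp add: pick_def)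
    then show False using N[of y] \<open>y \<ge> _\<close> by (simp add: S'_def)
  qed
  moreover have "q < y \<and> P q y" if "y \<in> S'" for y
    using that last_ge[of y] mono by (auto simp: S'_def pick_def intro: le_less_trans)
  moreover have "P x y" if "x \<in> S'" "y \<in> S'" "x < y" for x y
  proof -
    have "last (Suc x) = x" using that(1) by (simp add: S'_def last_Suc)
    then have "x \<le> last y" using mono_last[of "Suc x" y] that(3) by simp
    then show ?thesis using that(2) mono by (auto simp: S'_def pick_def)
  qed
  ultimately show ?thesis by blast
qed

end

section \<open>Ideals containing all arithmetical sets\<close>

lemma turing_join_le: "A \<le>\<^sub>T C \<Longrightarrow> B \<le>\<^sub>T C \<Longrightarrow> A \<oplus>\<^sub>T B \<le>\<^sub>T C"
proof -
  assume *: "A \<le>\<^sub>T C" "B \<le>\<^sub>T C"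
  have "z \<in> A \<oplus>\<^sub>T B \<longleftrightarrow> (\<exists>k\<le>z. z = 2 * k \<and> k \<in> A \<or> z = 2 * k + 1 \<and> k \<in> B)" for z
  proof -
    have "x \<le> 2 * x" "x \<le> 2 * x + 1" for x :: nat by simp_all
    then show ?thesis unfolding turing_join_def by blast
  qed
  then show ?thesis
    unfolding turing_le_decp
    by (simp only:) (intro comp_intros decp_mem[OF *(1)] decp_mem[OF *(2)])
qed

lemma empty_join_empty: "{} \<oplus>\<^sub>T {} = {}"
  by (simp add: turing_join_def)

lemma decp_Sigma0: "decp A P \<Longrightarrow> {x. P x} \<in> Sigma0 n A"
  by (rule Sigma0_mono[of 0]) (simp_all add: turing_le_decp)

lemma settling_time:
  fixes R :: "nat \<Rightarrow> nat \<Rightarrow> bool"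
  shows "\<exists>t. \<forall>u<x. (\<exists>s. R u s) \<longrightarrow> (\<exists>s<t. R u s)"
proof (induction x)
  case (Suc x)
  then obtain t where t: "\<forall>u<x. (\<exists>s. R u s) \<longrightarrow> (\<exists>s<t. R u s)" ..
  obtain r where r: "(\<exists>s. R x s) \<longrightarrow> R x r" by blast
  show ?case
  proof (rule exI[of _ "t + Suc r"], intro allI impI)
    fix u assume u: "u < Suc x" "\<exists>s. R u s"
    show "\<exists>s<t + Suc r. R u s"
    proof (cases "u = x")
      case True
      then show ?thesis using u r by (intro exI[of _ r]) simp
    next
      case False
      then obtain s where "s < t" "R u s" using u t by (metis less_antisym)
      then show ?thesis by (intro exI[of _ s]) simp
    qed
  qed
qed simp

section \<open>Indices of arithmetical sets and of computable conditions\<close>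

definition universal :: "nat \<Rightarrow> nat \<Rightarrow> nat \<Rightarrow> bool" where
  "universal k e = rec_nat (\<lambda>x. \<exists>t. conv {} e x 1 t) (\<lambda>_ U x. \<exists>y. \<not> U (pe x y)) k"

lemma universal_simps:
  "universal 0 e x \<longleftrightarrow> (\<exists>t. conv {} e x 1 t)"
  "universal (Suc k) e x \<longleftrightarrow> (\<exists>y. \<not> universal k e (pe x y))"
  by (simp_all add: universal_def)

text \<open>Level 0 also allows partial programs, so \<open>universal k\<close> may define more than
  the sets in \<open>Sigma0 k {}\<close>. The extra predicates merely add requirements to the
  construction of the generic.\<close>

lemma universal_complete: "S \<in> Sigma0 k {} \<Longrightarrow> \<exists>e. \<forall>x. x \<in> S \<longleftrightarrow> universal k e x"
proof (induction k arbitrary: S)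
  case 0
  then obtain e where "computes {} e S" by (auto simp: turing_le_def)
  then show ?case using computes_mem unfolding universal_simps by blast
next
  case (Suc k)
  from Suc.prems obtain P where P: "P \<in> Sigma0 k {}" "\<And>x. x \<in> S \<longleftrightarrow> (\<exists>y. pe x y \<notin> P)"
    by (rule Sigma0_SucE) blast
  obtain e where "\<forall>x. x \<in> P \<longleftrightarrow> universal k e x" using Suc.IH[OF P(1)] ..
  then have "\<forall>x. x \<in> S \<longleftrightarrow> universal (Suc k) e x" by (simp add: universal_simps P(2))
  then show ?case ..
qed

text \<open>COMP is presented by the pair ({}, {}), so the first of the two programs in an index
  already determines the reservoir. The predicate makes sense for every number, including those that
  index no condition.\<close>

definition index_mem :: "nat \<Rightarrow> nat \<Rightarrow> bool" where
  "index_mem i x \<longleftrightarrow> (\<exists>t. conv {} (pi1 (pi2 i)) x 1 t)"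

definition indexed :: "nat \<Rightarrow> condition" where
  "indexed i = (set_decode (pi1 i), {x. index_mem i x})"

definition comp_index :: "nat \<Rightarrow> bool" where
  "comp_index i \<longleftrightarrow> (\<exists>p. ideal_condition COMP p \<and> condition_index {} {} i p)"

lemma condition_index_indexed:
  assumes "ideal_condition COMP p" "condition_index {} {} i p"
  shows "p = indexed i"
  using assms computes_mem unfolding ideal_condition_def mathias_condition_def condition_index_def
  by (auto simp: indexed_def index_mem_def)

lemma comp_index_indexed: "comp_index i \<Longrightarrow> ideal_condition COMP (indexed i)"
  unfolding comp_index_def using condition_index_indexed by blast

lemma comp_index_exists:
  assumes "ideal_condition COMP p"
  shows "\<exists>i. condition_index {} {} i p"
  using assms unfolding ideal_condition_def condition_index_def
  by (cases p) (auto simp: COMP_def turing_le_def)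

lemma Sigma0_comp_index: "{i. comp_index i} \<in> Sigma0 3 {}"
proof -
  have "Sigma0_collection 3 COMP {} {} {(D, S). ideal_condition COMP (D, S) \<and>
       (\<forall>x\<in>S. \<forall>y\<in>S. x \<le> y \<longrightarrow> True) \<and> True}"
    by (rule Sigma0_collectionI[OF exact_pair_COMP _ _ _ refl]) (intro order_refl decp_const decp_Sigma0)+
  then show ?thesis unfolding Sigma0_collection_def comp_index_def empty_join_empty
    by (elim conjE back_subst[of "\<lambda>X. X \<in> Sigma0 3 {}"]) auto
qed

lemma extends_trans: "extends p q \<Longrightarrow> extends q r \<Longrightarrow> extends p r"
  by (cases p; cases q; cases r) (auto simp: extends_def)

lemma extends_indexed_iff:
  "extends (indexed i') (indexed i) \<longleftrightarrow>
     (\<forall>x. (x \<in> set_decode (pi1 i) \<longrightarrow> x \<in> set_decode (pi1 i')) \<and>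
       (x \<in> set_decode (pi1 i') \<longrightarrow> x \<in> set_decode (pi1 i) \<or> index_mem i x) \<and>
       (index_mem i' x \<longrightarrow> index_mem i x))"
  by (auto simp: extends_def indexed_def)

context generic_set
begin

lemma generic_unbounded: "\<exists>x\<in>G. m \<le> x"
proof -
  have "\<exists>D S. ideal_condition I (D, S) \<and> satisfies G (D, S) \<and>
        (\<forall>x\<in>S. \<forall>y\<in>S. x \<le> y \<longrightarrow> True) \<and> (\<exists>d<set_encode D. d \<in> set_decode (set_encode D) \<and> m \<le> d)"
  proof (rule generic_meets_dense)
    fix D S assume p: "ideal_condition I (D, S)"
    obtain y where y: "y \<in> S" "m \<le> y" using condition_unbounded[OF p] by blast
    let ?D = "insert y D"
    have "y \<in> set_decode (set_encode ?D)"
      using p by (simp add: ideal_condition_def mathias_condition_def)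
    then show "\<exists>D' S'. ideal_condition I (D', S') \<and> extends (D', S') (D, S) \<and>
        (\<forall>x\<in>S'. \<forall>y\<in>S'. x \<le> y \<longrightarrow> True) \<and> (\<exists>d<set_encode D'. d \<in> set_decode (set_encode D') \<and> m \<le> d)"
      using condition_insert[OF p y(1)] y(2) set_decode_less
      by (intro exI[of _ ?D] exI[of _ "{z \<in> S. y < z}"]) blast
  qed (intro decp_Sigma0 comp_intros)+
  then obtain D S d where "ideal_condition I (D, S)" "satisfies G (D, S)"
    "d \<in> set_decode (set_encode D)" "m \<le> d"
    by blast
  then show ?thesis
    by (auto simp: satisfies_def ideal_condition_def mathias_condition_def)
qed

text \<open>As Q is in I, a reservoir can be thinned with the help of Q itself so that for any x < y
  in it, all u < x that belong to Q are enumerated before stage y. G satisfies such a condition (D,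
  S), and its elements outside D lie in S. Hence u is outside Q as soon as two such elements of G
  above u show no enumeration of u before the larger one.\<close>

lemma generic_dominates:
  assumes B: "B \<in> I" "B \<le>\<^sub>T G" and R: "decp B (\<lambda>p. R (pi1 p) (pi2 p))"
    and Q: "{u. \<exists>t. R u t} \<in> I"
  shows "{u. \<exists>t. R u t} \<le>\<^sub>T G"
proof -
  define Q where "Q = {u. \<exists>t. R u t}"
  define P where "P x y \<longleftrightarrow> (\<forall>u<x. u \<in> Q \<longrightarrow> (\<exists>t<y. R u t))" for x y
  let ?Z = "Q \<oplus>\<^sub>T B"
  have Z: "?Z \<in> I" using ideal_join[OF Q B(1)] by (simp add: Q_def)
  have RC: "decp C (\<lambda>p. R (f p) (g p))" if "B \<le>\<^sub>T C" "compf C f" "compf C g" for C f g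
    using decp_comp[OF decp_mono[OF that(1) R] compf_pe[OF that(2,3)]] by simp
  have P: "decp ?Z (\<lambda>p. P (pi1 p) (pi2 p))"
    unfolding P_def by (intro comp_intros decp_mem[OF turing_le_join(1)] RC[OF turing_le_join(2)])
  have "\<exists>D S. ideal_condition I (D, S) \<and> satisfies G (D, S) \<and>
        (\<forall>x\<in>S. \<forall>y\<in>S. x \<le> y \<longrightarrow> (x < y \<longrightarrow> P x y)) \<and> True"
  proof (rule generic_meets_dense)
    have "decp (A0 \<oplus>\<^sub>T A1) (\<lambda>p. P (pi1 (pi2 p)) (pi2 (pi2 p)))"
      using decp_comp[OF decp_mono[OF ideal_oracle[OF Z] P] compf_pi2_id] .
    then show "decp (A0 \<oplus>\<^sub>T A1) (\<lambda>p. pi1 (pi2 p) < pi2 (pi2 p) \<longrightarrow> P (pi1 (pi2 p)) (pi2 (pi2 p)))"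
      by (intro comp_intros)
    fix D S assume p: "ideal_condition I (D, S)"
    have "\<exists>S'\<subseteq>S. infinite S' \<and> S' \<in> I \<and> (\<forall>y\<in>S'. 0 < y \<and> P 0 y) \<and> (\<forall>x\<in>S'. \<forall>y\<in>S'. x < y \<longrightarrow> P x y)"
    proof (rule thin[OF _ _ Z P])
      show "S \<in> I" "infinite S" using p by (auto simp: ideal_condition_def mathias_condition_def)
      show "P x' y" if "P x y" "x' \<le> x" for x x' y using that by (auto simp: P_def)
      fix x
      obtain t where t: "\<And>u. u < x \<Longrightarrow> \<exists>s. R u s \<Longrightarrow> \<exists>s<t. R u s"
        using settling_time[of x R] by blast
      have "P x y" if "t \<le> y" for y
        unfolding P_def
      proof (intro allI impI)
        fix u assume "u < x" "u \<in> Q"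
        then obtain s where "s < t" "R u s" using t unfolding Q_def by blast
        then show "\<exists>s<y. R u s" using that by (intro exI[of _ s]) simp
      qed
      then show "\<exists>t. \<forall>y\<ge>t. P x y" by blast
    qed
    then obtain S' where "S' \<subseteq> S" "infinite S'" "S' \<in> I" "\<forall>x\<in>S'. \<forall>y\<in>S'. x < y \<longrightarrow> P x y" by blast
    then show "\<exists>D' S'. ideal_condition I (D', S') \<and> extends (D', S') (D, S) \<and>
        (\<forall>x\<in>S'. \<forall>y\<in>S'. x \<le> y \<longrightarrow> (x < y \<longrightarrow> P x y)) \<and> True"
      using p by (intro exI[of _ D] exI[of _ S'])
        (auto simp: ideal_condition_def mathias_condition_def extends_def)
  qed (intro decp_Sigma0 comp_intros)
  then obtain D S where DS: "ideal_condition I (D, S)" "satisfies G (D, S)"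
    "\<And>x y. x \<in> S \<Longrightarrow> y \<in> S \<Longrightarrow> x < y \<Longrightarrow> P x y"
    by auto
  have fin: "finite D" using DS(1) by (auto simp: ideal_condition_def mathias_condition_def)
  have GS: "x \<in> S" if "x \<in> G" "x \<notin> set_decode (set_encode D)" for x
    using that DS(2) fin by (auto simp: satisfies_def)
  define W where "W u z \<longleftrightarrow> u < pi1 z \<and> pi1 z < pi2 z \<and> pi1 z \<in> G \<and> pi2 z \<in> G \<and>
     pi1 z \<notin> set_decode (set_encode D) \<and> pi2 z \<notin> set_decode (set_encode D) \<and> (\<forall>t<pi2 z. \<not> R u t)" for u z
  have "decp G (\<lambda>u. \<exists>t. R u t)"
  proof (rule decp_of_Sigma1[where P = R and Q = W])
    show "decp G (\<lambda>p. W (pi1 p) (pi2 p))"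
      unfolding W_def by (intro comp_intros decp_mem[OF turing_le_refl] RC[OF B(2)])
    show "decp G (\<lambda>p. R (pi1 p) (pi2 p))" by (intro comp_intros RC[OF B(2)])
    show "(\<exists>t. R u t) \<longleftrightarrow> (\<exists>y. R u y)" for u by (rule refl)
    show "\<not> (\<exists>t. R u t) \<longleftrightarrow> (\<exists>z. W u z)" for u
    proof
      assume n: "\<not> (\<exists>t. R u t)"
      obtain x where x: "x \<in> G" "x \<ge> Suc u + set_encode D" using generic_unbounded by blast
      obtain y where y: "y \<in> G" "y \<ge> Suc x" using generic_unbounded by blast
      have "W u (pe x y)"
        using x y n set_decode_less[of x "set_encode D"] set_decode_less[of y "set_encode D"]
        by (auto simp: W_def)
      then show "\<exists>z. W u z" ..
    next
      assume "\<exists>z. W u z"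
      then obtain z where z: "W u z" ..
      then have "P (pi1 z) (pi2 z)" using DS(3) GS by (auto simp: W_def)
      then show "\<not> (\<exists>t. R u t)" using z by (auto simp: W_def P_def Q_def)
    qed
  qed
  then show ?thesis by (simp add: turing_le_decp)
qed

section \<open>Predicates that lie both in the ideal and below the generic set\<close>

definition small :: "(nat \<Rightarrow> bool) \<Rightarrow> bool" where
  "small P \<longleftrightarrow> {x. P x} \<in> I \<and> {x. P x} \<le>\<^sub>T G"

lemma small_decp: "small P \<Longrightarrow> decp {x. P x} Q \<Longrightarrow> small Q"
proof -
  assume "small P" "decp {x. P x} Q"
  moreover then have "{x. Q x} \<le>\<^sub>T {x. P x}" by (simp add: turing_le_decp)
  ultimately show ?thesis unfolding small_def using ideal_le turing_le_trans by blast
qed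

lemma small_comp: "small P \<Longrightarrow> compf {} f \<Longrightarrow> small (\<lambda>x. P (f x))"
  using small_decp decp_mem[OF turing_le_refl compf_mono[OF empty_turing_le], of f "{x. P x}"] by simp

lemma small_not: "small P \<Longrightarrow> small (\<lambda>x. \<not> P x)"
  by (erule small_decp) (use decp_not[OF decp_oracle, of "{x. P x}"] in simp)

lemma small_computable: "decp {} P \<Longrightarrow> small P"
  unfolding small_def
  by (intro conjI ideal_computable) (auto simp: turing_le_decp intro: decp_mono[OF empty_turing_le])

lemma small_join: "small P \<Longrightarrow> small Q \<Longrightarrow> small (\<lambda>x. x \<in> {x. P x} \<oplus>\<^sub>T {x. Q x})"
  unfolding small_def by (simp add: ideal_join turing_join_le)

lemma small_conj: "small P \<Longrightarrow> small Q \<Longrightarrow> small (\<lambda>x. P x \<and> Q x)"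
proof -
  assume s: "small P" "small Q"
  let ?Z = "{x. P x} \<oplus>\<^sub>T {x. Q x}"
  have "decp ?Z (\<lambda>x. x \<in> {x. P x} \<and> x \<in> {x. Q x})"
    by (intro comp_intros decp_mem turing_le_join)
  then show ?thesis using small_decp[OF small_join[OF s]] by simp
qed

lemma small_disj: "small P \<Longrightarrow> small Q \<Longrightarrow> small (\<lambda>x. P x \<or> Q x)"
  using small_not[OF small_conj[OF small_not[of P] small_not[of Q]]] by simp

lemma small_imp: "small P \<Longrightarrow> small Q \<Longrightarrow> small (\<lambda>x. P x \<longrightarrow> Q x)"
  unfolding imp_conv_disj by (intro small_disj small_not)

end

locale generic_set_jump_closed = generic_set +
  assumes jump_closed: "\<And>B R. B \<in> I \<Longrightarrow> B \<le>\<^sub>T G \<Longrightarrow> decp B (\<lambda>p. R (pi1 p) (pi2 p)) \<Longrightarrow>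
    {u. \<exists>t. R u t} \<in> I"
begin

text \<open>Jump closure keeps the projection in I, and \<open>generic_dominates\<close> then brings
  it below G. Both halves of \<open>small\<close> are needed to pass one quantifier, so they are
  carried together.\<close>

lemma small_ex:
  assumes "small (\<lambda>p. P (pi1 p) (pi2 p))"
  shows "small (\<lambda>x. \<exists>y. P x y)"
proof -
  have "decp {p. P (pi1 p) (pi2 p)} (\<lambda>p. P (pi1 p) (pi2 p))"
    using decp_oracle[of "{p. P (pi1 p) (pi2 p)}"] by simp
  then show ?thesis
    using assms jump_closed generic_dominates unfolding small_def by blast
qed

lemma small_all: "small (\<lambda>p. P (pi1 p) (pi2 p)) \<Longrightarrow> small (\<lambda>x. \<forall>y. P x y)"
  using small_not[OF small_ex[OF small_not[of "\<lambda>p. P (pi1 p) (pi2 p)"]]] by simp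

lemma small_index_mem: "compf {} f \<Longrightarrow> compf {} g \<Longrightarrow> small (\<lambda>p. index_mem (f p) (g p))"
proof -
  have "small (\<lambda>p. index_mem (pi1 p) (pi2 p))"
    unfolding index_mem_def
    by (intro small_ex small_computable decp_conv turing_le_refl comp_intros)
  from small_comp[OF this compf_pe] show "compf {} f \<Longrightarrow> compf {} g \<Longrightarrow> ?thesis" by simp
qed

lemma small_universal: "small (\<lambda>p. universal k (pi1 p) (pi2 p))"
proof (induction k)
  case 0
  show ?case unfolding universal_simps
    by (intro small_ex small_computable decp_conv turing_le_refl comp_intros)
next
  case (Suc k)
  have "small (\<lambda>q. \<not> universal k (pi1 (pi1 q)) (pe (pi2 (pi1 q)) (pi2 q)))"
    using small_not[OF small_comp[OF Suc, of "\<lambda>q. pe (pi1 (pi1 q)) (pe (pi2 (pi1 q)) (pi2 q))"]]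
    by (simp add: comp_intros)
  then show ?case unfolding universal_simps by (rule small_ex)
qed

lemma small_Sigma0: "S \<in> Sigma0 k {} \<Longrightarrow> small (\<lambda>x. x \<in> S)"
proof -
  assume "S \<in> Sigma0 k {}"
  then obtain e where "\<And>x. x \<in> S \<longleftrightarrow> universal k e x" using universal_complete by blast
  then show ?thesis using small_comp[OF small_universal, of "\<lambda>x. pe e x"] by (simp add: comp_intros)
qed

definition refines :: "nat \<Rightarrow> nat \<Rightarrow> nat \<Rightarrow> bool" where
  "refines e i i' \<longleftrightarrow> universal n e i' \<and> comp_index i' \<and> extends (indexed i') (indexed i)"

lemma small_refines: "small (\<lambda>p. refines (pi1 (pi1 p)) (pi2 (pi1 p)) (pi2 p))"
proof -
  have "small (\<lambda>p. universal n (pi1 (pi1 p)) (pi2 p))"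
    using small_comp[OF small_universal, of "\<lambda>p. pe (pi1 (pi1 p)) (pi2 p)"] by (simp add: comp_intros)
  moreover have "small (\<lambda>p. comp_index (pi2 p))"
    using small_comp[OF small_Sigma0[OF Sigma0_comp_index] compf_pi2_id] by simp
  ultimately show ?thesis
    unfolding refines_def extends_indexed_iff
    by (intro small_all small_conj small_imp small_disj small_index_mem)
      (assumption | intro small_computable comp_intros)+
qed

text \<open>Requirement e is handled at stage e: pass to an index of an extension in the e-th
  collection if there is one, and stay otherwise. The questions asked are arithmetical, hence
  \<open>small\<close>, so the whole sequence of indices is computable in a member of I below
  G.\<close>

lemma exists_comp_generic: "\<exists>H. H \<le>\<^sub>T G \<and> mathias_generic n COMP {} {} H"
proof -
  define ex where "ex p \<longleftrightarrow> (\<exists>i'. refines (pi1 p) (pi2 p) i')" for p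
  have sex: "small ex" unfolding ex_def by (intro small_ex small_refines)
  \<comment> \<open>The default \<open>pi2 p\<close> makes the search total, so that
    \<open>next_index\<close> is computable in Z.\<close>
  define next_index where
    "next_index p = (LEAST i'. if ex p then refines (pi1 p) (pi2 p) i' else i' = pi2 p)" for p
  define Z where "Z = {p. refines (pi1 (pi1 p)) (pi2 (pi1 p)) (pi2 p)} \<oplus>\<^sub>T {p. ex p}"
  have sZ: "small (\<lambda>x. x \<in> Z)" unfolding Z_def by (rule small_join[OF small_refines sex])
  have Zref: "decp Z (\<lambda>p. refines (pi1 (pi1 p)) (pi2 (pi1 p)) (pi2 p))" and Zex: "decp Z ex"
    using turing_le_join(1)[of "{p. refines (pi1 (pi1 p)) (pi2 (pi1 p)) (pi2 p)}" "{p. ex p}"]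
      turing_le_join(2)[of "{p. ex p}" "{p. refines (pi1 (pi1 p)) (pi2 (pi1 p)) (pi2 p)}"]
    unfolding turing_le_decp Z_def[symmetric] mem_Collect_eq by simp_all
  have next_ex: "\<exists>i'. if ex p then refines (pi1 p) (pi2 p) i' else i' = pi2 p" for p
    by (auto simp: ex_def)
  have Znext: "compf Z next_index"
    unfolding next_index_def using decp_comp[OF Zex compf_pi1_id]
    by (intro compf_Least next_ex decp_if Zref comp_intros)
  have "UNIV \<le>\<^sub>T {}" by (simp add: turing_le_decp decp_const)
  then have "ideal_condition COMP ({}, UNIV)"
    by (simp add: ideal_condition_def mathias_condition_def COMP_def)
  then obtain i0 where i0: "comp_index i0" using comp_index_exists comp_index_def by blast
  define q where "q j = rec_nat i0 (\<lambda>j i. next_index (pe j i)) j" for j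
  have q_Suc: "q (Suc j) = next_index (pe j (q j))" for j by (simp add: q_def)
  have Zq: "compf Z q" unfolding q_def by (intro comp_intros compf_comp[OF Znext])
  have step: "if ex (pe j (q j)) then refines j (q j) (q (Suc j)) else q (Suc j) = q j" for j
  proof -
    have "if ex p then refines (pi1 p) (pi2 p) (next_index p) else next_index p = pi2 p" for p
      unfolding next_index_def by (rule LeastI_ex[OF next_ex])
    from this[of "pe j (q j)"] show ?thesis unfolding q_Suc pi_pe .
  qed
  have valid: "comp_index (q j)" for j
  proof (induction j)
    case 0 show ?case using i0 by (simp add: q_def)
  next
    case (Suc j) then show ?case using step[of j] by (auto simp: refines_def split: if_splits)
  qed
  have ext: "extends (indexed (q (j + k))) (indexed (q j))" for j k
  proof (induction k)
    case 0 show ?case by (simp add: extends_def indexed_def)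
  next
    case (Suc k)
    have "extends (indexed (q (Suc (j + k)))) (indexed (q (j + k)))"
      using step[of "j + k"] by (auto simp: refines_def extends_def indexed_def split: if_splits)
    then show ?case using Suc extends_trans by simp
  qed
  define H where "H = {x. \<exists>j. x \<in> set_decode (pi1 (q j))}"
  have sat: "satisfies H (indexed (q j))" for j
  proof -
    have "x \<in> set_decode (pi1 (q j)) \<or> index_mem (q j) x" if "x \<in> set_decode (pi1 (q k))" for x k
    proof (cases "k \<le> j")
      case True
      then show ?thesis using that ext[of k "j - k"] by (auto simp: extends_def indexed_def)
    next
      case False
      then show ?thesis using that ext[of j "k - j"] by (auto simp: extends_def indexed_def)
    qed
    then show ?thesis by (auto simp: satisfies_def indexed_def H_def)
  qed
  have "H \<le>\<^sub>T G"
  proof -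
    \<comment> \<open>H is a projection of this predicate, and one more use of
      \<open>small_ex\<close> brings it below G.\<close>
    have "decp Z (\<lambda>p. pi1 p \<in> set_decode (pi1 (q (pi2 p))))"
      by (intro comp_intros compf_comp[OF Zq])
    then have "small (\<lambda>p. pi1 p \<in> set_decode (pi1 (q (pi2 p))))"
      using small_decp[OF sZ] by simp
    from small_ex[OF this] show ?thesis by (simp add: small_def H_def)
  qed
  moreover have "mathias_generic n COMP {} {} H"
    unfolding mathias_generic_def
  proof (intro allI impI)
    fix C assume C: "Sigma0_collection n COMP {} {} C"
    then obtain e where e: "\<And>i. (\<exists>p\<in>C. condition_index {} {} i p) \<longleftrightarrow> universal n e i"
      using universal_complete unfolding Sigma0_collection_def empty_join_empty by blast
    have ideal_C: "ideal_condition COMP p" if "p \<in> C" for p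
      using C that by (auto simp: Sigma0_collection_def)
    show "meets H C \<or> avoids COMP H C"
    proof (cases "ex (pe e (q e))")
      case True
      then have "universal n e (q (Suc e))" using step[of e] by (simp add: refines_def)
      then obtain p where "p \<in> C" "condition_index {} {} (q (Suc e)) p" using e by blast
      then have "p \<in> C" "satisfies H p"
        using condition_index_indexed[OF ideal_C] sat by metis+
      then show ?thesis by (auto simp: meets_def)
    next
      case False
      have "\<not> extends p (indexed (q e))" if p: "p \<in> C" for p
      proof
        assume x: "extends p (indexed (q e))"
        obtain i where i: "condition_index {} {} i p" using comp_index_exists[OF ideal_C[OF p]] ..
        have "comp_index i" unfolding comp_index_def using i ideal_C[OF p] by blast
        moreover have "universal n e i" using e p i by blast
        ultimately have "refines e (q e) i"
          unfolding refines_def using x condition_index_indexed[OF ideal_C[OF p] i] by simp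
        then show False using False by (auto simp: ex_def)
      qed
      then show ?thesis
        using comp_index_indexed[OF valid[of e]] sat[of e] unfolding avoids_def by blast
    qed
  qed
  ultimately show ?thesis by blast
qed

end

section \<open>Coding computable conditions into a generic set\<close>

lemma finite_bound_ex:
  fixes P :: "'a \<Rightarrow> nat \<Rightarrow> bool"
  assumes "finite X" "\<And>x t t'. P x t \<Longrightarrow> t \<le> t' \<Longrightarrow> P x t'" "\<And>x. x \<in> X \<Longrightarrow> \<exists>t. P x t"
  shows "\<exists>t. \<forall>x\<in>X. P x t"
proof -
  from assms(3) obtain f where f: "\<And>x. x \<in> X \<Longrightarrow> P x (f x)" by metis
  have "P x (sum f X)" if "x \<in> X" for x
    using assms(2)[OF f[OF that]] member_le_sum[of x X f] that assms(1) by simp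
  then show ?thesis by blast
qed

text \<open>Stacks are numbers read through \<^const>\<open>list_decode\<close>; the tail of the empty stack 0 is again 0.\<close>

definition stack_tail :: "nat \<Rightarrow> nat" where "stack_tail s = pi2 (s - 1)"
definition stack_push :: "nat \<Rightarrow> nat \<Rightarrow> nat" where "stack_push a s = Suc (pe a s)"
definition stack_items :: "nat \<Rightarrow> nat set" where "stack_items s = set (list_decode s)"

lemma list_decode_push [simp]: "list_decode (stack_push a s) = a # list_decode s"
  by (simp add: stack_push_def)

lemma list_decode_tail [simp]: "list_decode (stack_tail s) = tl (list_decode s)"
proof (cases s)
  case 0
  then show ?thesis by (simp add: stack_tail_def)
next
  case (Suc k)
  then show ?thesis by (auto simp: stack_tail_def pi2_def split: prod.split)
qed

lemma list_decode_tails: "list_decode ((stack_tail ^^ k) s) = drop k (list_decode s)"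
  by (induction k) (simp_all add: drop_Suc tl_drop)

lemma hd_list_decode: "s \<noteq> 0 \<Longrightarrow> hd (list_decode s) = pi1 (s - 1)"
  by (cases s) (auto simp: pi1_def split: prod.split)

lemma list_decode_eq_Nil_iff: "list_decode s = [] \<longleftrightarrow> s = 0"
  by (cases s) (auto split: prod.split)

lemma length_list_decode: "length (list_decode s) \<le> s"
proof -
  have "length xs \<le> list_encode xs" for xs
  proof (induction xs)
    case (Cons x xs)
    have "list_encode xs \<le> pe x (list_encode xs)" by (rule le_prod_encode_2)
    then show ?case using Cons by simp
  qed simp
  from this[of "list_decode s"] show ?thesis by simp
qed

lemma Ball_stack_items:
  "(\<forall>b\<in>stack_items s. P b) \<longleftrightarrow>
   (\<forall>k<s. (stack_tail ^^ k) s \<noteq> 0 \<longrightarrow> P (pi1 ((stack_tail ^^ k) s - 1)))"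
proof -
  have "(\<forall>b\<in>stack_items s. P b) \<longleftrightarrow> (\<forall>k<length (list_decode s). P (list_decode s ! k))"
    by (simp add: stack_items_def all_set_conv_all_nth)
  also have "\<dots> \<longleftrightarrow> (\<forall>k<s. k < length (list_decode s) \<longrightarrow> P (list_decode s ! k))"
    using length_list_decode[of s] by (meson less_le_trans)
  also have "\<dots> \<longleftrightarrow> (\<forall>k<s. (stack_tail ^^ k) s \<noteq> 0 \<longrightarrow> P (pi1 ((stack_tail ^^ k) s - 1)))"
  proof -
    have "(stack_tail ^^ k) s \<noteq> 0 \<longleftrightarrow> k < length (list_decode s)" for k
      using list_decode_eq_Nil_iff[of "(stack_tail ^^ k) s"] by (auto simp: list_decode_tails)
    moreover have "pi1 ((stack_tail ^^ k) s - 1) = list_decode s ! k" if "k < length (list_decode s)" for k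
      using hd_list_decode[of "(stack_tail ^^ k) s"] that calculation
      by (simp add: list_decode_tails hd_drop_conv_nth)
    ultimately show ?thesis by metis
  qed
  finally show ?thesis .
qed

lemma stack_items_push [simp]: "stack_items (stack_push a s) = insert a (stack_items s)"
  by (simp add: stack_items_def)

lemma finite_stack_items: "finite (stack_items s)"
  by (simp add: stack_items_def)

definition item_mem :: "nat \<Rightarrow> nat \<Rightarrow> nat \<Rightarrow> bool" where
  "item_mem b y t \<longleftrightarrow> conv {} (pi1 (pi2 b)) y 1 t"

definition stack_mem :: "nat \<Rightarrow> nat \<Rightarrow> nat \<Rightarrow> bool" where
  "stack_mem s y t \<longleftrightarrow> (\<forall>b\<in>stack_items s. item_mem b y t)"

definition stack_set :: "nat \<Rightarrow> nat set" where
  "stack_set s = {y. \<exists>t. stack_mem s y t}"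

text \<open>
  Evidence up to \<open>x\<close>, found within \<open>t\<close> steps, that all sets on the stack are decidable and that
  their intersection is infinite.
\<close>

definition passes :: "nat \<Rightarrow> nat \<Rightarrow> nat \<Rightarrow> bool" where
  "passes s x t \<longleftrightarrow>
     (\<forall>b\<in>stack_items s. \<forall>y\<le>x. item_mem b y t \<or> conv {} (pi1 (pi2 b)) y 0 t) \<and>
     (\<exists>y\<le>t. x < y \<and> stack_mem s y t)"

text \<open>Only the finite part of \<open>a\<close> is tested. Inclusion of its reservoir in the
  earlier ones cannot be decided; intersecting all entries of the stack takes its place. New
  elements must exceed the old ones, which later makes the enumerated set decidable.\<close>

definition accepts :: "nat \<Rightarrow> nat \<Rightarrow> nat \<Rightarrow> nat \<Rightarrow> bool" where
  "accepts h s a t \<longleftrightarrow> (\<forall>x\<in>set_decode h. x \<in> set_decode (pi1 a)) \<and>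
     (\<forall>x\<in>set_decode (pi1 a). x \<notin> set_decode h \<longrightarrow> (\<forall>d\<in>set_decode h. d < x) \<and> stack_mem s x t)"

lemma item_mem_mono: "item_mem b y t \<Longrightarrow> t \<le> t' \<Longrightarrow> item_mem b y t'"
  unfolding item_mem_def by (rule conv_mono)

lemma stack_mem_mono: "stack_mem s y t \<Longrightarrow> t \<le> t' \<Longrightarrow> stack_mem s y t'"
  unfolding stack_mem_def using item_mem_mono by blast

lemma passes_mono: "passes s x t \<Longrightarrow> x' \<le> x \<Longrightarrow> t \<le> t' \<Longrightarrow> passes s x' t'"
  unfolding passes_def using item_mem_mono conv_mono stack_mem_mono
  by (meson le_less_trans le_trans)

lemma stack_set_iff: "y \<in> stack_set s \<longleftrightarrow> (\<forall>b\<in>stack_items s. index_mem b y)"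
  using finite_bound_ex[OF finite_stack_items, of "\<lambda>b. item_mem b y" s] item_mem_mono
  unfolding stack_set_def stack_mem_def index_mem_def item_mem_def by blast

lemma accepts_mono: "accepts h s a t \<Longrightarrow> t \<le> t' \<Longrightarrow> accepts h s a t'"
  unfolding accepts_def using stack_mem_mono by blast

lemma conv_functional: "conv A e x y t \<Longrightarrow> conv A e x z t' \<Longrightarrow> y = z"
  using conv_iff[of A e x y] conv_iff[of A e x z] evals_deterministic inj_encode_code
  unfolding inj_def by metis

lemma decp_item_mem:
  "compf A f \<Longrightarrow> compf A g \<Longrightarrow> compf A h \<Longrightarrow> decp A (\<lambda>p. item_mem (f p) (g p) (h p))"
  unfolding item_mem_def by (intro decp_conv comp_intros empty_turing_le)

lemma decp_stack_mem:
  assumes "compf A f" "compf A g" "compf A h"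
  shows "decp A (\<lambda>p. stack_mem (f p) (g p) (h p))"
proof -
  have "decp A (\<lambda>p. stack_mem (pi1 p) (pi1 (pi2 p)) (pi2 (pi2 p)))"
    unfolding stack_mem_def Ball_stack_items stack_tail_def
    by (intro comp_intros decp_item_mem)
  from decp_comp[OF this, of "\<lambda>p. pe (f p) (pe (g p) (h p))"] show ?thesis
    using assms by (simp add: comp_intros)
qed

lemma decp_passes:
  assumes "compf A f" "compf A g" "compf A h"
  shows "decp A (\<lambda>p. passes (f p) (g p) (h p))"
proof -
  have "decp A (\<lambda>p. passes (pi1 p) (pi1 (pi2 p)) (pi2 (pi2 p)))"
    unfolding passes_def Ball_stack_items stack_tail_def
    by (intro comp_intros decp_item_mem decp_stack_mem decp_conv empty_turing_le)
  from decp_comp[OF this, of "\<lambda>p. pe (f p) (pe (g p) (h p))"] show ?thesis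
    using assms by (simp add: comp_intros)
qed

lemma decp_accepts:
  assumes "compf A f" "compf A g" "compf A h" "compf A k"
  shows "decp A (\<lambda>p. accepts (f p) (g p) (h p) (k p))"
proof -
  have "decp A (\<lambda>p. accepts (pi1 p) (pi1 (pi2 p)) (pi1 (pi2 (pi2 p))) (pi2 (pi2 (pi2 p))))"
    unfolding accepts_def Ball_set_decode
    by (intro comp_intros decp_stack_mem)
  from decp_comp[OF this, of "\<lambda>p. pe (f p) (pe (g p) (pe (h p) (k p)))"] show ?thesis
    using assms by (simp add: comp_intros)
qed

text \<open>Success at every x means that each entry answers 0 or 1 everywhere and that the common
  part is unbounded. A number outside the common part is recognised by an entry answering 0, so
  Post's theorem applies.\<close>

lemma stack_set_computable:
  assumes "\<And>x. \<exists>t. passes s x t"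
  shows "stack_set s \<le>\<^sub>T {}" "infinite (stack_set s)"
proof -
  have dec: "\<exists>t. \<forall>b\<in>stack_items s. item_mem b y t \<or> conv {} (pi1 (pi2 b)) y 0 t" for y
    using assms[of y] unfolding passes_def by blast
  define out where "out y t \<longleftrightarrow> \<not> (\<forall>b\<in>stack_items s. \<not> conv {} (pi1 (pi2 b)) y 0 t)" for y t
  have "decp {} (\<lambda>y. y \<in> stack_set s)"
  proof (rule decp_of_Sigma1[where P = "stack_mem s" and Q = out])
    show "decp {} (\<lambda>p. stack_mem s (pi1 p) (pi2 p))" by (intro decp_stack_mem comp_intros)
    show "decp {} (\<lambda>p. out (pi1 p) (pi2 p))"
      unfolding out_def Ball_stack_items stack_tail_def by (intro comp_intros decp_conv turing_le_refl)
    show "y \<in> stack_set s \<longleftrightarrow> (\<exists>t. stack_mem s y t)" for y by (simp add: stack_set_def)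
    show "y \<notin> stack_set s \<longleftrightarrow> (\<exists>t. out y t)" for y
    proof
      assume y: "y \<notin> stack_set s"
      obtain t where "\<forall>b\<in>stack_items s. item_mem b y t \<or> conv {} (pi1 (pi2 b)) y 0 t"
        using dec by blast
      moreover have "\<not> (\<forall>b\<in>stack_items s. item_mem b y t)"
        using y by (auto simp: stack_set_def stack_mem_def)
      ultimately show "\<exists>t. out y t" unfolding out_def by blast
    next
      assume "\<exists>t. out y t"
      then obtain t b where b: "b \<in> stack_items s" "conv {} (pi1 (pi2 b)) y 0 t"
        unfolding out_def by blast
      then have "\<not> index_mem b y" using conv_functional unfolding index_mem_def by fastforce
      then show "y \<notin> stack_set s" using b(1) by (auto simp: stack_set_iff)
    qed
  qed
  then show "stack_set s \<le>\<^sub>T {}" by (simp add: turing_le_decp)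
  have "\<exists>y\<in>stack_set s. x < y" for x
    using assms[of x] unfolding passes_def stack_set_def by blast
  then show "infinite (stack_set s)" by (meson finite_nat_set_iff_bounded less_asym)
qed

text \<open>This is the survival of honest entries: as the reservoir of \<open>a\<close> already
  lies in the stack set, the new intersection is that reservoir, which is decidable and
  infinite.\<close>

lemma passes_push:
  assumes good: "\<And>x. \<exists>t. passes s x t" and a: "comp_index a"
    and sub: "\<And>y. index_mem a y \<Longrightarrow> y \<in> stack_set s"
  shows "\<exists>t. passes (stack_push a s) x t"
proof -
  obtain T where T: "ideal_condition COMP (set_decode (pi1 a), T)" "computes {} (pi1 (pi2 a)) T"
    "T = {y. index_mem a y}"
  proof -
    from a obtain p where p: "ideal_condition COMP p" "condition_index {} {} a p"
      unfolding comp_index_def by blast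
    then have "p = indexed a" by (rule condition_index_indexed)
    then show ?thesis
      using p by (intro that[of "{y. index_mem a y}"])
        (auto simp: indexed_def condition_index_def, metis pi_pe(1,2))
  qed
  have "\<exists>t. item_mem a y t \<or> conv {} (pi1 (pi2 a)) y 0 t" for y
    using computes_conv_iff[OF T(2), of y "char_fun T y"] unfolding item_mem_def char_fun_def
    by (auto split: if_splits)
  then have "\<exists>t. \<forall>y\<in>{..x}. item_mem a y t \<or> conv {} (pi1 (pi2 a)) y 0 t"
    by (intro finite_bound_ex) (auto intro: item_mem_mono conv_mono)
  then obtain t1 where t1: "\<And>y. y \<le> x \<Longrightarrow> item_mem a y t1 \<or> conv {} (pi1 (pi2 a)) y 0 t1" by auto
  obtain t2 where t2: "passes s x t2" using good by blast
  obtain y where y: "x < y" "y \<in> T"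
    using T(1) by (auto simp: ideal_condition_def mathias_condition_def infinite_nat_iff_unbounded)
  then have "y \<in> stack_set (stack_push a s)"
    using sub T(3) by (auto simp: stack_set_iff)
  then obtain t3 where t3: "stack_mem (stack_push a s) y t3" by (auto simp: stack_set_def)
  have "passes (stack_push a s) x (t1 + t2 + t3 + y)"
    unfolding passes_def
  proof
    show "\<exists>z\<le>t1 + t2 + t3 + y. x < z \<and> stack_mem (stack_push a s) z (t1 + t2 + t3 + y)"
      using y(1) stack_mem_mono[OF t3] by (intro exI[of _ y]) simp
    have "item_mem a z (t1 + t2 + t3 + y) \<or> conv {} (pi1 (pi2 a)) z 0 (t1 + t2 + t3 + y)" if "z \<le> x" for z
      using t1[OF that] item_mem_mono[of a z t1 "t1 + t2 + t3 + y"]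
        conv_mono[of "{}" "pi1 (pi2 a)" z 0 t1 "t1 + t2 + t3 + y"] by auto
    moreover have "passes s x (t1 + t2 + t3 + y)" using passes_mono[OF t2] by simp
    ultimately show "\<forall>b\<in>stack_items (stack_push a s). \<forall>z\<le>x.
        item_mem b z (t1 + t2 + t3 + y) \<or> conv {} (pi1 (pi2 b)) z 0 (t1 + t2 + t3 + y)"
      by (auto simp: passes_def)
  qed
  then show ?thesis ..
qed

text \<open>
  A state consists of the last two elements \<open>p < q\<close> read from the oracle, the number \<open>c\<close> of bits 0
  since the last bit 1, the part \<open>h\<close> of \<open>H\<close> enumerated so far, and the stack \<open>s\<close>.
\<close>

definition mk_state :: "nat \<Rightarrow> nat \<Rightarrow> nat \<Rightarrow> nat \<Rightarrow> nat \<Rightarrow> nat" where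
  "mk_state p q c h s = pe p (pe q (pe c (pe h s)))"
definition st_p :: "nat \<Rightarrow> nat" where "st_p \<sigma> = pi1 \<sigma>"
definition st_q :: "nat \<Rightarrow> nat" where "st_q \<sigma> = pi1 (pi2 \<sigma>)"
definition st_c :: "nat \<Rightarrow> nat" where "st_c \<sigma> = pi1 (pi2 (pi2 \<sigma>))"
definition st_h :: "nat \<Rightarrow> nat" where "st_h \<sigma> = pi1 (pi2 (pi2 (pi2 \<sigma>)))"
definition st_s :: "nat \<Rightarrow> nat" where "st_s \<sigma> = pi2 (pi2 (pi2 (pi2 \<sigma>)))"

lemma st_mk_state [simp]:
  "st_p (mk_state p q c h s) = p" "st_q (mk_state p q c h s) = q" "st_c (mk_state p q c h s) = c"
  "st_h (mk_state p q c h s) = h" "st_s (mk_state p q c h s) = s"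
  by (simp_all add: mk_state_def st_p_def st_q_def st_c_def st_h_def st_s_def)

definition end_extends :: "nat \<Rightarrow> nat \<Rightarrow> bool" where
  "end_extends h h' \<longleftrightarrow> set_decode h \<subseteq> set_decode h' \<and>
     (\<forall>x\<in>set_decode h' - set_decode h. \<forall>d\<in>set_decode h. d < x)"

lemma end_extends_trans: "end_extends h h' \<Longrightarrow> end_extends h' h'' \<Longrightarrow> end_extends h h''"
  unfolding end_extends_def by blast

section \<open>The decoder\<close>

context
  fixes R :: "nat \<Rightarrow> nat \<Rightarrow> bool"
begin

text \<open>
  The bit coded by three consecutive elements \<open>p < q < r\<close> of the oracle is 1 if the part below \<open>p\<close> of
  the set enumerated by \<open>R\<close> has visibly not settled at stage \<open>q\<close>.
\<close>

definition coded_bit :: "nat \<Rightarrow> nat \<Rightarrow> nat \<Rightarrow> bool" where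
  "coded_bit p q r \<longleftrightarrow> (\<exists>u<p. (\<exists>t<r. R u t) \<and> \<not> (\<exists>t<q. R u t))"

definition checked_stack :: "nat \<Rightarrow> nat \<Rightarrow> nat" where
  "checked_stack r \<sigma> = (if passes (st_s \<sigma>) (st_q \<sigma>) r then st_s \<sigma> else stack_tail (st_s \<sigma>))"

text \<open>
  The counter \<open>c\<close> proposes the index \<open>pi1 c\<close>, so every index is proposed by arbitrarily large
  counters and can be reached without pushing anything else before it.
\<close>

definition update :: "nat \<Rightarrow> nat \<Rightarrow> nat" where
  "update r \<sigma> =
    (if coded_bit (st_p \<sigma>) (st_q \<sigma>) r then
       if accepts (st_h \<sigma>) (checked_stack r \<sigma>) (pi1 (st_c \<sigma>)) r
       then mk_state (st_q \<sigma>) r 0 (pi1 (pi1 (st_c \<sigma>))) (stack_push (pi1 (st_c \<sigma>)) (checked_stack r \<sigma>))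
       else mk_state (st_q \<sigma>) r 0 (st_h \<sigma>) (checked_stack r \<sigma>)
     else mk_state (st_q \<sigma>) r (Suc (st_c \<sigma>)) (st_h \<sigma>) (checked_stack r \<sigma>))"

text \<open>Initially p = q = 0 stand for elements not yet read. No u is below 0, so the first two
  elements carry the bit 0. The values h = 0 and s = 0 are the empty set and the empty
  stack.\<close>

definition run :: "nat set \<Rightarrow> nat \<Rightarrow> nat" where
  "run X m = rec_nat (mk_state 0 0 0 0 0) (\<lambda>k \<sigma>. if k \<in> X then update k \<sigma> else \<sigma>) m"

text \<open>The code of a finite set exceeds its elements, so all of D has been read at that point,
  and the state is computable from the canonical index of D.\<close>

definition final_state :: "nat set \<Rightarrow> nat" where
  "final_state D = run D (set_encode D)"

lemma run_Suc: "run X (Suc m) = (if m \<in> X then update m (run X m) else run X m)"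
  by (simp add: run_def)

lemma run_cong: "(\<And>k. k < m \<Longrightarrow> k \<in> X \<longleftrightarrow> k \<in> Y) \<Longrightarrow> run X m = run Y m"
proof (induction m)
  case 0
  show ?case by (simp add: run_def)
next
  case (Suc m)
  have "run X m = run Y m" by (rule Suc.IH) (simp add: Suc.prems)
  then show ?case using Suc.prems[of m] by (simp add: run_Suc)
qed

lemma run_const: "D \<subseteq> {..<m} \<Longrightarrow> run D (m + k) = run D m"
  by (induction k) (auto simp: run_Suc)

lemma run_final:
  assumes "finite D" "D \<subseteq> {..<m}"
  shows "run D m = final_state D"
proof -
  have "D \<subseteq> {..<set_encode D}" using assms(1) set_decode_less[of _ "set_encode D"] by auto
  then have "run D (set_encode D + m) = final_state D" by (simp add: run_const final_state_def)
  moreover have "run D (m + set_encode D) = run D m" by (rule run_const[OF assms(2)])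
  ultimately show ?thesis by (simp add: add.commute)
qed

lemma final_state_insert:
  assumes "finite D" "\<And>d. d \<in> D \<Longrightarrow> d < y"
  shows "final_state (insert y D) = update y (final_state D)"
proof -
  have "final_state (insert y D) = run (insert y D) (Suc y)"
    using assms by (intro run_final[symmetric]) (auto simp: less_Suc_eq)
  also have "\<dots> = update y (run (insert y D) y)" by (simp add: run_Suc)
  also have "run (insert y D) y = run D y" by (rule run_cong) auto
  also have "\<dots> = final_state D" using assms by (intro run_final) auto
  finally show ?thesis .
qed

lemma run_satisfies:
  assumes "mathias_condition (D, S)" "satisfies X (D, S)"
  shows "run X (LEAST s. s \<in> S) = final_state D"
proof -
  let ?m = "LEAST s. s \<in> S"
  have "S \<noteq> {}" using assms(1) by (auto simp: mathias_condition_def)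
  then have "?m \<in> S" by (meson LeastI_ex ex_in_conv)
  then have D: "finite D" "D \<subseteq> {..<?m}" using assms(1) by (auto simp: mathias_condition_def)
  have "run X ?m = run D ?m"
  proof (rule run_cong)
    fix s assume "s < ?m"
    then have "s \<notin> S" using not_less_Least by blast
    then show "s \<in> X \<longleftrightarrow> s \<in> D" using assms(2) by (auto simp: satisfies_def)
  qed
  then show ?thesis using run_final[OF D] by simp
qed

lemma update_end_extends: "end_extends (st_h \<sigma>) (st_h (update r \<sigma>))"
  by (auto simp: update_def end_extends_def accepts_def)

lemma run_end_extends: "m \<le> m' \<Longrightarrow> end_extends (st_h (run X m)) (st_h (run X m'))"
proof (induction m' rule: dec_induct)
  case base
  show ?case by (simp add: end_extends_def)
next
  case (step k)
  then show ?case using update_end_extends end_extends_trans by (auto simp: run_Suc)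
qed

section \<open>Conditions that force the stack to survive\<close>

definition clean_at :: "nat \<Rightarrow> nat \<Rightarrow> nat \<Rightarrow> bool" where
  "clean_at \<sigma> x y \<longleftrightarrow> passes (st_s \<sigma>) (st_q \<sigma>) y \<and> \<not> coded_bit (st_p \<sigma>) (st_q \<sigma>) y \<and>
     (x < y \<longrightarrow> passes (st_s \<sigma>) x y)"

text \<open>An element y of S may be read directly after D, when its predecessor is
  \<open>st_q\<close> and its bit has to be 0, or after another element x of S. Success of all these
  checks means that no set satisfying (D, S) ever loses an entry now on the stack. The formulation
  through pairs from S matches \<open>Sigma0_collectionI\<close>.\<close>

definition clean :: "nat set \<Rightarrow> nat set \<Rightarrow> bool" where
  "clean D S \<longleftrightarrow> (\<forall>x\<in>S. \<forall>y\<in>S. x \<le> y \<longrightarrow> clean_at (final_state D) x y)"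

definition generated :: "nat set \<Rightarrow> nat set" where
  "generated X = {x. \<exists>m. x \<in> set_decode (st_h (run X m))}"

text \<open>Pops affect only the top. Once the entries above the original stack are gone, the check
  concerns exactly the original stack and succeeds by cleanness, so that part is never touched.
  Acceptance therefore always tests new elements against a stack containing it.\<close>

lemma clean_invariant:
  assumes mc: "mathias_condition (D, S)" and cl: "clean D S" and sat: "satisfies X (D, S)"
    and m: "(LEAST s. s \<in> S) \<le> m"
  defines "\<sigma> \<equiv> final_state D"
  shows "(\<exists>l. list_decode (st_s (run X m)) = l @ list_decode (st_s \<sigma>)) \<and>
    (st_q (run X m) = st_q \<sigma> \<or> st_q (run X m) \<in> S \<and> st_q (run X m) < m) \<and>
    (\<forall>x\<in>set_decode (st_h (run X m)). x \<notin> set_decode (st_h \<sigma>) \<longrightarrow> x \<in> stack_set (st_s \<sigma>))"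
  using m
proof (induction m rule: dec_induct)
  case base
  show ?case by (simp add: run_satisfies[OF mc sat] \<sigma>_def)
next
  case (step m)
  let ?\<tau> = "run X m"
  show ?case
  proof (cases "m \<in> X")
    case False
    then show ?thesis using step.IH by (auto simp: run_Suc)
  next
    case True
    have "S \<noteq> {}" using mc by (auto simp: mathias_condition_def)
    then have "(LEAST s. s \<in> S) \<in> S" by (meson LeastI_ex ex_in_conv)
    then have "d < (LEAST s. s \<in> S)" if "d \<in> D" for d
      using mc that by (auto simp: mathias_condition_def)
    then have "m \<notin> D" using step.hyps(1) by (meson not_less)
    then have mS: "m \<in> S" using True sat by (auto simp: satisfies_def)
    \<comment> \<open>The last element read is either \<open>st_q\<close> of the original state or a
      member of S; these are the two kinds of check in \<open>clean_at\<close>.\<close>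
    have pass: "passes (st_s \<sigma>) (st_q ?\<tau>) m"
      using step.IH cl mS unfolding clean_def clean_at_def \<sigma>_def[symmetric] by (metis less_imp_le order_refl)
    obtain l where l: "list_decode (st_s ?\<tau>) = l @ list_decode (st_s \<sigma>)" using step.IH by blast
    have "\<exists>l. list_decode (checked_stack m ?\<tau>) = l @ list_decode (st_s \<sigma>)"
    proof (cases "passes (st_s ?\<tau>) (st_q ?\<tau>) m")
      case True
      then show ?thesis using l by (auto simp: checked_stack_def)
    next
      case False
      have "l \<noteq> []"
      proof
        assume "l = []"
        then have "st_s ?\<tau> = st_s \<sigma>" using l by (metis append_Nil list_decode_inverse)
        then show False using False pass by simp
      qed
      then show ?thesis using False l by (auto simp: checked_stack_def)
    qed
    then obtain l' where l': "list_decode (checked_stack m ?\<tau>) = l' @ list_decode (st_s \<sigma>)" by blast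
    then have items: "stack_items (st_s \<sigma>) \<subseteq> stack_items (checked_stack m ?\<tau>)"
      by (auto simp: stack_items_def)
    have "\<exists>l. list_decode (st_s (update m ?\<tau>)) = l @ list_decode (st_s \<sigma>)"
      using l' by (auto simp: update_def)
    moreover have "st_q (update m ?\<tau>) = m" by (simp add: update_def)
    moreover have "x \<in> stack_set (st_s \<sigma>)"
      if "x \<in> set_decode (st_h (update m ?\<tau>))" "x \<notin> set_decode (st_h \<sigma>)" for x
    proof (cases "x \<in> set_decode (st_h ?\<tau>)")
      case True
      then show ?thesis using that step.IH by blast
    next
      case False
      then have "stack_mem (checked_stack m ?\<tau>) x m"
        using that by (auto simp: update_def accepts_def split: if_splits)
      then have "stack_mem (st_s \<sigma>) x m" using items by (auto simp: stack_mem_def)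
      then show ?thesis by (auto simp: stack_set_def)
    qed
    ultimately show ?thesis using True mS by (simp add: run_Suc)
  qed
qed

text \<open>A clean condition forces on the generated set the condition described by its state:
  elements enumerated later have been tested against the present entries, and end extension puts
  them above the present part.\<close>

lemma clean_generated:
  assumes mc: "mathias_condition (D, S)" and cl: "clean D S" and sat: "satisfies X (D, S)"
  defines "\<sigma> \<equiv> final_state D"
  shows "satisfies (generated X)
    (set_decode (st_h \<sigma>), {y \<in> stack_set (st_s \<sigma>). \<forall>d\<in>set_decode (st_h \<sigma>). d < y})"
proof -
  let ?m = "LEAST s. s \<in> S"
  have m: "run X ?m = \<sigma>" unfolding \<sigma>_def by (rule run_satisfies[OF mc sat])
  have "x \<in> stack_set (st_s \<sigma>) \<and> (\<forall>d\<in>set_decode (st_h \<sigma>). d < x)"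
    if x: "x \<in> set_decode (st_h (run X k))" "x \<notin> set_decode (st_h \<sigma>)" for x k
  proof -
    have "?m \<le> k"
    proof (rule ccontr)
      assume "\<not> ?m \<le> k"
      then have "end_extends (st_h (run X k)) (st_h (run X ?m))" by (intro run_end_extends) simp
      then show False using x m by (auto simp: end_extends_def)
    qed
    then show ?thesis
      using clean_invariant[OF mc cl sat, of k] run_end_extends[of ?m k X] x m
      by (auto simp: \<sigma>_def end_extends_def)
  qed
  then show ?thesis using m unfolding satisfies_def generated_def by auto
qed

end

section \<open>Forcing with coded bits\<close>

locale generic_set_coding = generic_set +
  fixes B :: "nat set" and R :: "nat \<Rightarrow> nat \<Rightarrow> bool"
  assumes B_ideal: "B \<in> I" and B_le: "B \<le>\<^sub>T G"
    and R: "decp B (\<lambda>p. R (pi1 p) (pi2 p))"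
    and not_ideal: "{u. \<exists>t. R u t} \<notin> I"
begin

lemma decp_R: "B \<le>\<^sub>T C \<Longrightarrow> compf C f \<Longrightarrow> compf C g \<Longrightarrow> decp C (\<lambda>p. R (f p) (g p))"
  using decp_comp[OF decp_mono[OF _ R] compf_pe] by simp

lemma decp_coded_bit:
  assumes "B \<le>\<^sub>T C" "compf C f" "compf C g" "compf C h"
  shows "decp C (\<lambda>p. coded_bit R (f p) (g p) (h p))"
proof -
  have "decp C (\<lambda>p. coded_bit R (pi1 p) (pi1 (pi2 p)) (pi2 (pi2 p)))"
    unfolding coded_bit_def by (intro comp_intros decp_R[OF assms(1)])
  from decp_comp[OF this, of "\<lambda>p. pe (f p) (pe (g p) (h p))"] show ?thesis
    using assms by (simp add: comp_intros)
qed

lemma compf_update: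
  assumes "B \<le>\<^sub>T C" "compf C f" "compf C g"
  shows "compf C (\<lambda>p. update R (f p) (g p))"
proof -
  have "compf C (\<lambda>p. update R (pi1 p) (pi2 p))"
    unfolding update_def checked_stack_def mk_state_def stack_push_def stack_tail_def
      st_p_def st_q_def st_c_def st_h_def st_s_def
    by (intro comp_intros decp_coded_bit[OF assms(1)] decp_accepts decp_passes)
  from compf_comp[OF this, of "\<lambda>p. pe (f p) (g p)"] show ?thesis
    using assms by (simp add: comp_intros)
qed

lemma compf_run:
  assumes "B \<le>\<^sub>T C" "decp C (\<lambda>p. pi2 p \<in> X (pi1 p))" "compf C m"
  shows "compf C (\<lambda>e. run R (X e) (m e))"
proof -
  have "decp C (\<lambda>p. pi1 (pi2 p) \<in> X (pi1 p))"
    using decp_comp[OF assms(2), of "\<lambda>p. pe (pi1 p) (pi1 (pi2 p))"] by (simp add: comp_intros)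
  then show ?thesis
    unfolding run_def by (intro comp_intros compf_update assms)
qed

lemma compf_final_state: "B \<le>\<^sub>T C \<Longrightarrow> compf C (\<lambda>h. final_state R (set_decode h))"
  unfolding final_state_def set_decode_inverse by (intro compf_run comp_intros)

lemma decp_clean_at:
  assumes "B \<le>\<^sub>T C"
  shows "decp C (\<lambda>p. clean_at R (final_state R (set_decode (pi1 p))) (pi1 (pi2 p)) (pi2 (pi2 p)))"
  unfolding clean_at_def st_p_def st_q_def st_s_def
  by (intro comp_intros decp_coded_bit[OF assms] decp_passes compf_comp[OF compf_final_state[OF assms]])

text \<open>The set is enumerated by end extensions. If it is infinite, x is excluded for good once
  a larger element has appeared without it; the finite case is nonuniform.\<close>

lemma generated_le: "generated R G \<le>\<^sub>T G"
proof (cases "finite (generated R G)")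
  case True
  have "decp G (\<lambda>x. x \<in> set_decode (set_encode (generated R G)))" by (intro comp_intros)
  then show ?thesis using True by (simp add: turing_le_decp)
next
  case False
  define h where "h m = st_h (run R G m)" for m
  have "compf G (run R G)"
    by (intro compf_run comp_intros B_le decp_mem turing_le_refl)
  then have h: "compf G h" unfolding h_def st_h_def by (intro comp_intros)
  define out where "out x m \<longleftrightarrow> x \<notin> set_decode (h m) \<and> (\<exists>d<h m. d \<in> set_decode (h m) \<and> x < d)" for x m
  have "decp G (\<lambda>x. x \<in> generated R G)"
  proof (rule decp_of_Sigma1[where P = "\<lambda>x m. x \<in> set_decode (h m)" and Q = out])
    show "decp G (\<lambda>p. pi1 p \<in> set_decode (h (pi2 p)))"
      by (intro comp_intros compf_comp[OF h])
    show "decp G (\<lambda>p. out (pi1 p) (pi2 p))"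
      unfolding out_def by (intro comp_intros compf_comp[OF h])
    show "x \<in> generated R G \<longleftrightarrow> (\<exists>m. x \<in> set_decode (h m))" for x
      by (simp add: generated_def h_def)
    show "x \<notin> generated R G \<longleftrightarrow> (\<exists>m. out x m)" for x
    proof
      assume x: "x \<notin> generated R G"
      obtain d where d: "d \<in> generated R G" "x < d" using False by (meson infinite_nat_iff_unbounded)
      then obtain m where "d \<in> set_decode (h m)" by (auto simp: generated_def h_def)
      then have "out x m"
        using x d(2) set_decode_less[of d "h m"] by (auto simp: out_def generated_def h_def)
      then show "\<exists>m. out x m" ..
    next
      assume "\<exists>m. out x m"
      then obtain m d where m: "x \<notin> set_decode (h m)" "d \<in> set_decode (h m)" "x < d"
        by (auto simp: out_def)
      show "x \<notin> generated R G"
      proof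
        assume "x \<in> generated R G"
        then obtain k where k: "x \<in> set_decode (h k)" by (auto simp: generated_def h_def)
        show False
        proof (cases "k \<le> m")
          case True
          then show False using run_end_extends[of k m R G] k m(1) by (auto simp: end_extends_def h_def)
        next
          case False
          then have "end_extends (h m) (h k)" unfolding h_def by (intro run_end_extends) simp
          then have "d < x" using k m(1,2) by (auto simp: end_extends_def)
          then show False using m(3) by simp
        qed
      qed
    qed
  qed
  then show ?thesis by (simp add: turing_le_decp)
qed

text \<open>At a stage q past the settling time of the part below p, nothing remains to be seen. A
  large q thus fixes the bit of p, q, r as 0 for every r, which is how pushes are
  suppressed.\<close>

lemma eventually_no_bit: "\<exists>t. \<forall>q\<ge>t. \<forall>r. \<not> coded_bit R p q r"
proof -
  obtain t where t: "\<And>u. u < p \<Longrightarrow> \<exists>s. R u s \<Longrightarrow> \<exists>s<t. R u s" using settling_time[of p R] by blast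
  have "\<not> coded_bit R p q r" if "t \<le> q" for q r
  proof
    assume "coded_bit R p q r"
    then obtain u s where u: "u < p" "R u s" "\<And>s. s < q \<Longrightarrow> \<not> R u s" by (auto simp: coded_bit_def)
    then obtain s' where "s' < t" "R u s'" using t by blast
    then show False using u(3)[of s'] that by simp
  qed
  then show ?thesis by blast
qed

text \<open>If no two elements of \<open>S\<close> coded the bit 1, then \<open>S\<close> and \<open>B\<close> together would decide the set enumerated by \<open>R\<close>.\<close>

lemma exists_bit:
  assumes S: "S \<in> I" "infinite S"
  shows "\<exists>x\<in>S. \<exists>y\<in>S. x < y \<and> (\<exists>t. \<forall>z\<ge>t. coded_bit R x y z)"
proof (rule ccontr)
  assume none: "\<not> ?thesis"
  have sep: "\<exists>t<y. R u t" if xy: "x \<in> S" "y \<in> S" "x < y" "u < x" "R u s" for x y u s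
  proof (rule ccontr)
    assume n: "\<not> (\<exists>t<y. R u t)"
    have "coded_bit R x y z" if "z \<ge> Suc s" for z
      unfolding coded_bit_def using n xy(4,5) that by (intro exI[of _ u] conjI exI[of _ s]) auto
    then show False using none xy(1-3) by blast
  qed
  let ?Z = "S \<oplus>\<^sub>T B"
  define out where "out u z \<longleftrightarrow> u < pi1 z \<and> pi1 z < pi2 z \<and> pi1 z \<in> S \<and> pi2 z \<in> S \<and>
     \<not> (\<exists>t<pi2 z. R u t)" for u z
  have "decp ?Z (\<lambda>u. \<exists>t. R u t)"
  proof (rule decp_of_Sigma1[where P = R and Q = out])
    show "decp ?Z (\<lambda>p. R (pi1 p) (pi2 p))" by (rule decp_mono[OF turing_le_join(2) R])
    show "decp ?Z (\<lambda>p. out (pi1 p) (pi2 p))"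
      unfolding out_def
      by (intro comp_intros decp_mem[OF turing_le_join(1)] decp_R[OF turing_le_join(2)])
    show "(\<exists>t. R u t) \<longleftrightarrow> (\<exists>t. R u t)" for u by (rule refl)
    show "\<not> (\<exists>t. R u t) \<longleftrightarrow> (\<exists>z. out u z)" for u
    proof
      assume n: "\<not> (\<exists>t. R u t)"
      obtain x where x: "x \<in> S" "u < x" using S(2) by (meson infinite_nat_iff_unbounded)
      obtain y where y: "y \<in> S" "x < y" using S(2) by (meson infinite_nat_iff_unbounded)
      have "out u (pe x y)" using x y n by (simp add: out_def)
      then show "\<exists>z. out u z" ..
    next
      assume "\<exists>z. out u z"
      then show "\<not> (\<exists>t. R u t)" unfolding out_def using sep by blast
    qed
  qed
  then have "{u. \<exists>t. R u t} \<in> I" by (rule ideal_decp[OF ideal_join[OF S(1) B_ideal]])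
  then show False using not_ideal by simp
qed

lemma conditionD:
  assumes "ideal_condition I (D, S)"
  shows "finite D" "infinite S" "S \<in> I" "\<And>d s. d \<in> D \<Longrightarrow> s \<in> S \<Longrightarrow> d < s" "mathias_condition (D, S)"
  using assms by (auto simp: ideal_condition_def mathias_condition_def)

lemma state_insert:
  assumes "ideal_condition I (D, S)" "y \<in> S"
  shows "final_state R (insert y D) = update R y (final_state R D)"
  using conditionD[OF assms(1)] assms(2) by (intro final_state_insert) auto

lemma update_no_bit:
  assumes "\<not> coded_bit R (st_p \<sigma>) (st_q \<sigma>) y" "passes (st_s \<sigma>) (st_q \<sigma>) y"
  shows "update R y \<sigma> = mk_state (st_q \<sigma>) y (Suc (st_c \<sigma>)) (st_h \<sigma>) (st_s \<sigma>)"
  using assms by (simp add: update_def checked_stack_def)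

text \<open>\<open>passes\<close> has the monotonicity required by \<open>thin\<close>. Starting the
  selection at \<open>st_q\<close> also secures the check of the first element, and
  \<open>settled\<close> makes the bit of that element 0.\<close>

lemma clean_thin:
  assumes cond: "ideal_condition I (D, S)" and good: "\<And>x. \<exists>t. passes (st_s (final_state R D)) x t"
    and settled: "\<And>r. \<not> coded_bit R (st_p (final_state R D)) (st_q (final_state R D)) r"
  shows "\<exists>S'. ideal_condition I (D, S') \<and> extends (D, S') (D, S) \<and> clean R D S'"
proof -
  let ?s = "st_s (final_state R D)" and ?q = "st_q (final_state R D)"
  have "\<exists>S'\<subseteq>S. infinite S' \<and> S' \<in> I \<and> (\<forall>y\<in>S'. ?q < y \<and> passes ?s ?q y) \<and>
      (\<forall>x\<in>S'. \<forall>y\<in>S'. x < y \<longrightarrow> passes ?s x y)"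
  proof (rule thin[where X = "{}"])
    show "{} \<in> I" by (rule ideal_computable[OF turing_le_refl])
    show "decp {} (\<lambda>p. passes ?s (pi1 p) (pi2 p))" by (intro decp_passes comp_intros)
    show "\<exists>t. \<forall>y\<ge>t. passes ?s x y" for x using good[of x] passes_mono by blast
    show "passes ?s x' y" if "passes ?s x y" "x' \<le> x" for x x' y using passes_mono[OF that order_refl] .
  qed (use conditionD[OF cond] in auto)
  then obtain S' where "S' \<subseteq> S" "infinite S'" "S' \<in> I" "\<And>y. y \<in> S' \<Longrightarrow> passes ?s ?q y"
    "\<And>x y. x \<in> S' \<Longrightarrow> y \<in> S' \<Longrightarrow> x < y \<Longrightarrow> passes ?s x y" by blast
  then show ?thesis
    using conditionD[OF cond] settled
    by (intro exI[of _ S'])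
      (auto simp: ideal_condition_def mathias_condition_def extends_def clean_def clean_at_def)
qed

text \<open>
  Large elements with bit 0 leave the finite part unchanged and pop the stack until only honest
  entries remain.
\<close>

lemma clean_dense_settled:
  assumes "ideal_condition I (D, S)"
    and "\<And>r. \<not> coded_bit R (st_p (final_state R D)) (st_q (final_state R D)) r"
  shows "\<exists>D' S'. ideal_condition I (D', S') \<and> extends (D', S') (D, S) \<and> clean R D' S'"
  using assms
proof (induction "length (list_decode (st_s (final_state R D)))" arbitrary: D S rule: less_induct)
  case (less D S)
  define \<sigma> where "\<sigma> = final_state R D"
  note cond = less.prems(1)
  show ?case
  proof (cases "\<forall>x. \<exists>t. passes (st_s \<sigma>) x t")
    case True
    then show ?thesis using clean_thin[OF cond] less.prems(2) unfolding \<sigma>_def by blast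
  next
    case False
    then obtain x0 where x0: "\<And>t. \<not> passes (st_s \<sigma>) x0 t" by blast
    have "list_decode (st_s \<sigma>) \<noteq> []"
    proof
      assume "list_decode (st_s \<sigma>) = []"
      then have "passes (st_s \<sigma>) x0 (Suc x0)"
        by (auto simp: passes_def stack_mem_def stack_items_def)
      then show False using x0 by blast
    qed
    then have shorter: "length (list_decode (stack_tail (st_s \<sigma>))) < length (list_decode (st_s \<sigma>))"
      by simp
    obtain t where t: "\<And>q r. t \<le> q \<Longrightarrow> \<not> coded_bit R (st_q \<sigma>) q r"
      using eventually_no_bit by blast
    \<comment> \<open>Being beyond t, y makes the next bit 0 whatever is read next. Being beyond x0,
      it makes the check at the next element fail, since that check covers x0. So the stack is
      popped at y or at the element after it.\<close>
    obtain y where y: "y \<in> S" "x0 + t \<le> y" using condition_unbounded[OF cond] by blast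
    let ?D1 = "insert y D" and ?S1 = "{z \<in> S. y < z}"
    note cond1 = condition_insert[OF cond y(1)]
    have st1: "final_state R ?D1 = mk_state (st_q \<sigma>) y (Suc (st_c \<sigma>)) (st_h \<sigma>) (checked_stack y \<sigma>)"
      using state_insert[OF cond y(1)] less.prems(2) by (simp add: update_def \<sigma>_def)
    have settled1: "\<not> coded_bit R (st_p (final_state R ?D1)) (st_q (final_state R ?D1)) r" for r
      using t[of y r] y(2) by (simp add: st1)
    show ?thesis
    proof (cases "passes (st_s \<sigma>) (st_q \<sigma>) y")
      case False
      then have "length (list_decode (st_s (final_state R ?D1))) < length (list_decode (st_s (final_state R D)))"
        using shorter by (simp add: st1 checked_stack_def \<sigma>_def)
      from less.hyps[OF this cond1(1) settled1] show ?thesis using cond1(2) extends_trans by blast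
    next
      case True
      obtain t' where t': "\<And>q r. t' \<le> q \<Longrightarrow> \<not> coded_bit R y q r"
        using eventually_no_bit by blast
      obtain y' where y': "y' \<in> ?S1" "t' \<le> y'" using condition_unbounded[OF cond1(1)] by blast
      let ?D2 = "insert y' ?D1"
      note cond2 = condition_insert[OF cond1(1) y'(1)]
      have "\<not> passes (st_s \<sigma>) y y'"
        using x0 passes_mono[of "st_s \<sigma>" y y' x0 y'] y(2) by auto
      then have st2: "final_state R ?D2 =
          mk_state y y' (Suc (Suc (st_c \<sigma>))) (st_h \<sigma>) (stack_tail (st_s \<sigma>))"
        using state_insert[OF cond1(1) y'(1)] settled1[of y'] True
        by (simp add: st1 update_def checked_stack_def)
      have "length (list_decode (st_s (final_state R ?D2))) < length (list_decode (st_s (final_state R D)))"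
        using shorter by (simp add: st2 \<sigma>_def)
      moreover have "\<not> coded_bit R (st_p (final_state R ?D2)) (st_q (final_state R ?D2)) r" for r
        using t'[of y' r] y'(2) by (simp add: st2)
      ultimately show ?thesis
        using less.hyps[OF _ cond2(1)] cond1(2) cond2(2) extends_trans by meson
    qed
  qed
qed

text \<open>Two elements y < y', the second beyond the settling time for y, make the next bit 0.
  Whatever dishonest entries the stack then holds are removed by
  \<open>clean_dense_settled\<close>.\<close>

lemma clean_dense:
  assumes cond: "ideal_condition I (D, S)"
  shows "\<exists>D' S'. ideal_condition I (D', S') \<and> extends (D', S') (D, S) \<and> clean R D' S' \<and> (\<exists>d\<in>D'. m \<le> d)"
proof -
  obtain y where y: "y \<in> S" "m \<le> y" using condition_unbounded[OF cond] by blast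
  note cond1 = condition_insert[OF cond y(1)]
  obtain t where t: "\<And>q r. t \<le> q \<Longrightarrow> \<not> coded_bit R y q r" using eventually_no_bit by blast
  obtain y' where y': "y' \<in> {z \<in> S. y < z}" "t \<le> y'" using condition_unbounded[OF cond1(1)] by blast
  note cond2 = condition_insert[OF cond1(1) y'(1)]
  let ?D = "insert y' (insert y D)"
  have "st_p (final_state R ?D) = y" "st_q (final_state R ?D) = y'"
    by (simp_all add: state_insert[OF cond1(1) y'(1)] state_insert[OF cond y(1)] update_def)
  then have "\<not> coded_bit R (st_p (final_state R ?D)) (st_q (final_state R ?D)) r" for r
    using t y'(2) by simp
  from clean_dense_settled[OF cond2(1) this] obtain D' S' where D': "ideal_condition I (D', S')"
    "extends (D', S') (?D, {z \<in> {z \<in> S. y < z}. y' < z})" "clean R D' S'" by blast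
  have "extends (D', S') (D, S)" using D'(2) cond1(2) cond2(2) extends_trans by blast
  moreover have "y \<in> D'" using D'(2) by (auto simp: extends_def)
  ultimately show ?thesis using D' y(2) by blast
qed

text \<open>The next element taken from a clean reservoir is read with bit 0 and without a pop;
  chosen beyond the settling time for \<open>st_q\<close>, it leaves the condition clean.\<close>

lemma clean_step:
  assumes cond: "ideal_condition I (D, S)" and cl: "clean R D S"
  shows "\<exists>D' S'. ideal_condition I (D', S') \<and> extends (D', S') (D, S) \<and> clean R D' S' \<and>
    st_c (final_state R D') = Suc (st_c (final_state R D)) \<and>
    st_h (final_state R D') = st_h (final_state R D) \<and> st_s (final_state R D') = st_s (final_state R D)"
proof -
  define \<sigma> where "\<sigma> = final_state R D"
  obtain t where t: "\<And>q r. t \<le> q \<Longrightarrow> \<not> coded_bit R (st_q \<sigma>) q r" using eventually_no_bit by blast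
  obtain y where y: "y \<in> S" "t \<le> y" using condition_unbounded[OF cond] by blast
  have cl': "clean_at R \<sigma> x z" if "x \<in> S" "z \<in> S" "x \<le> z" for x z
    using cl that by (auto simp: clean_def \<sigma>_def)
  have st: "final_state R (insert y D) = mk_state (st_q \<sigma>) y (Suc (st_c \<sigma>)) (st_h \<sigma>) (st_s \<sigma>)"
    using state_insert[OF cond y(1)] cl'[of y y] y(1)
    by (simp add: update_no_bit clean_at_def \<sigma>_def[symmetric])
  have "clean R (insert y D) {z \<in> S. y < z}"
    using cl' y t by (auto simp: clean_def st clean_at_def)
  then show ?thesis
    using condition_insert[OF cond y(1)] st unfolding \<sigma>_def
    by (intro exI[of _ "insert y D"] exI[of _ "{z \<in> S. y < z}"]) simp
qed

lemma clean_count: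
  assumes cond: "ideal_condition I (D, S)" and cl: "clean R D S" and c: "st_c (final_state R D) \<le> c"
  shows "\<exists>D' S'. ideal_condition I (D', S') \<and> extends (D', S') (D, S) \<and> clean R D' S' \<and>
    st_c (final_state R D') = c \<and>
    st_h (final_state R D') = st_h (final_state R D) \<and> st_s (final_state R D') = st_s (final_state R D)"
  using c
proof (induction c rule: dec_induct)
  case base
  have "extends (D, S) (D, S)" by (simp add: extends_def)
  then show ?case using cond cl by blast
next
  case (step c)
  then obtain D' S' where "ideal_condition I (D', S')" "extends (D', S') (D, S)" "clean R D' S'"
    "st_c (final_state R D') = c" "st_h (final_state R D') = st_h (final_state R D)"
    "st_s (final_state R D') = st_s (final_state R D)" by blast
  then show ?case using clean_step[of D' S'] extends_trans by metis
qed

lemma clean_good: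
  assumes cond: "ideal_condition I (D, S)" and cl: "clean R D S"
  shows "\<exists>t. passes (st_s (final_state R D)) x t"
proof -
  obtain x' where x': "x' \<in> S" "x \<le> x'" using condition_unbounded[OF cond] by blast
  obtain y where y: "y \<in> S" "Suc x' \<le> y" using condition_unbounded[OF cond] by blast
  have "passes (st_s (final_state R D)) x' y" using cl x' y by (auto simp: clean_def clean_at_def)
  then show ?thesis using passes_mono x'(2) by blast
qed

text \<open>The index is submitted by waiting: bits 0 raise the counter to a number whose first
  component is \<open>a\<close>, and a bit 1 follows. The bit of x < y < z is read only at z, so x
  and y themselves still count as bits 0.\<close>

lemma clean_push:
  assumes cond: "ideal_condition I (D, S)" and cl: "clean R D S" and a: "comp_index a"
  defines "\<sigma> \<equiv> final_state R D"
  assumes ext: "extends (indexed a)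
    (set_decode (st_h \<sigma>), {y \<in> stack_set (st_s \<sigma>). \<forall>d\<in>set_decode (st_h \<sigma>). d < y})"
  shows "\<exists>D' S'. ideal_condition I (D', S') \<and> extends (D', S') (D, S) \<and> clean R D' S' \<and>
    st_h (final_state R D') = pi1 a \<and> st_s (final_state R D') = stack_push a (st_s \<sigma>)"
proof -
  define h where "h = st_h \<sigma>"
  define s where "s = st_s \<sigma>"
  have sub: "set_decode h \<subseteq> set_decode (pi1 a)"
    and new: "\<And>x. x \<in> set_decode (pi1 a) - set_decode h \<Longrightarrow> x \<in> stack_set s \<and> (\<forall>d\<in>set_decode h. d < x)"
    and mem: "\<And>y. index_mem a y \<Longrightarrow> y \<in> stack_set s"
    using ext by (auto simp: extends_def indexed_def h_def s_def)
  have "\<exists>t. \<forall>x\<in>set_decode (pi1 a) - set_decode h. stack_mem s x t"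
    using new by (intro finite_bound_ex) (auto simp: stack_set_def elim: stack_mem_mono)
  then obtain t2 where t2: "accepts h s a t2" using sub new unfolding accepts_def by blast
  \<comment> \<open>The first component of k proposes \<open>a\<close>, and the second puts k at
    least two above the present counter. Counting stops at k - 2, since the elements x and y that
    carry the bit 1 are themselves read with bits 0.\<close>
  define k where "k = pe a (st_c \<sigma> + 2)"
  have "st_c \<sigma> + 2 \<le> k" unfolding k_def by (rule le_prod_encode_2)
  then obtain c where c: "k = Suc (Suc c)" "st_c \<sigma> \<le> c"
    by (metis add_2_eq_Suc' Suc_le_D Suc_le_mono)
  have "pi1 k = a" by (simp add: k_def)
  from clean_count[OF cond cl, of c] c(2) obtain D1 S1 where cond1: "ideal_condition I (D1, S1)"
    and ext1: "extends (D1, S1) (D, S)" and cl1: "clean R D1 S1"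
    and st1: "st_c (final_state R D1) = c" "st_h (final_state R D1) = h" "st_s (final_state R D1) = s"
    unfolding \<sigma>_def h_def s_def by blast
  define p q where "p = st_p (final_state R D1)" and "q = st_q (final_state R D1)"
  have pass: "passes s q y" "\<not> coded_bit R p q y" "x < y \<Longrightarrow> passes s x y"
    if "x \<in> S1" "y \<in> S1" "x \<le> y" for x y
    using cl1 that by (auto simp: clean_def clean_at_def st1 p_def q_def)
  \<comment> \<open>Restricting x to values from t1 on fixes the bit of q, x, y as 0 for whatever y
    \<open>exists_bit\<close> delivers.\<close>
  obtain t1 where t1: "\<And>q' r. t1 \<le> q' \<Longrightarrow> \<not> coded_bit R q q' r" using eventually_no_bit by blast
  have "{z \<in> S1. t1 \<le> z} \<in> I"
    using conditionD[OF cond1] by (intro ideal_decp[of S1] comp_intros decp_oracle) auto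
  moreover have "infinite {z \<in> S1. t1 \<le> z}"
    using condition_unbounded[OF cond1] unfolding infinite_nat_iff_unbounded_le
    by (metis (mono_tags, lifting) le_trans linear mem_Collect_eq)
  ultimately obtain x y t3 where xy: "x \<in> S1" "t1 \<le> x" "y \<in> S1" "x < y"
    and t3: "\<And>z. t3 \<le> z \<Longrightarrow> coded_bit R x y z"
    using exists_bit[of "{z \<in> S1. t1 \<le> z}"] by auto
  obtain t4 where t4: "\<And>q' r. t4 \<le> q' \<Longrightarrow> \<not> coded_bit R y q' r" using eventually_no_bit by blast
  \<comment> \<open>The bound t2 lets \<open>a\<close> be accepted, t3 makes the bit 1 visible, t4
    rules out a further bit right after the push, and Suc y places z after y.\<close>
  obtain z where z: "z \<in> S1" "t2 + t3 + t4 + Suc y \<le> z" using condition_unbounded[OF cond1] by blast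
  let ?S2 = "{w \<in> S1. x < w}"
  note cond2 = condition_insert[OF cond1 xy(1)]
  have y2: "y \<in> ?S2" using xy by simp
  note cond3 = condition_insert[OF cond2(1) y2]
  have z3: "z \<in> {w \<in> ?S2. y < w}" using z xy by simp
  note cond4 = condition_insert[OF cond3(1) z3]
  let ?D4 = "insert z (insert y (insert x D1))"
  have st2: "final_state R (insert x D1) = mk_state q x (Suc c) h s"
    using state_insert[OF cond1 xy(1)] pass[OF xy(1) xy(1)] st1
    by (simp add: update_no_bit p_def q_def)
  have st3: "final_state R (insert y (insert x D1)) = mk_state x y k h s"
    using state_insert[OF cond2(1) y2] pass(3)[OF xy(1) xy(3)] xy t1[of x y]
    by (simp add: update_no_bit st2 c(1))
  have "passes s y z" using pass(3)[OF xy(3) z(1)] z(2) by simp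
  moreover have "coded_bit R x y z" using t3 z(2) by simp
  moreover have "accepts h s a z" using accepts_mono[OF t2] z(2) by simp
  ultimately have st4: "final_state R ?D4 = mk_state y z 0 (pi1 a) (stack_push a s)"
    using state_insert[OF cond3(1) z3] by (simp add: st3 update_def checked_stack_def \<open>pi1 k = a\<close>)
  have good: "\<exists>t. passes s x t" for x using clean_good[OF cond cl] by (simp add: s_def \<sigma>_def)
  obtain S' where S': "ideal_condition I (?D4, S')"
    "extends (?D4, S') (?D4, {w \<in> {w \<in> ?S2. y < w}. z < w})" "clean R ?D4 S'"
    using clean_thin[OF cond4(1)] passes_push[OF good a mem] t4 z(2) by (auto simp: st4)
  have "extends (?D4, S') (D, S)"
    using S'(2) cond4(2) cond3(2) cond2(2) ext1 extends_trans by blast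
  then show ?thesis using S' st4 by (intro exI[of _ ?D4] exI[of _ S']) (simp add: s_def)
qed

section \<open>Transfer of genericity to the decoded set\<close>

lemma clean_iff:
  assumes "ideal_condition I (D, S)"
  shows "clean R D S \<longleftrightarrow>
    (\<forall>x\<in>S. \<forall>y\<in>S. x \<le> y \<longrightarrow> clean_at R (final_state R (set_decode (set_encode D))) x y)"
  using conditionD(1)[OF assms] by (simp add: clean_def)

lemma oracle_B: "B \<le>\<^sub>T A0 \<oplus>\<^sub>T A1"
  by (rule ideal_oracle[OF B_ideal])

lemma meets_clean: "\<exists>D S. ideal_condition I (D, S) \<and> satisfies G (D, S) \<and> clean R D S \<and> (\<exists>d\<in>D. m \<le> d)"
proof -
  have "\<exists>D S. ideal_condition I (D, S) \<and> satisfies G (D, S) \<and>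
      (\<forall>x\<in>S. \<forall>y\<in>S. x \<le> y \<longrightarrow> clean_at R (final_state R (set_decode (set_encode D))) x y) \<and>
      (\<exists>d<set_encode D. d \<in> set_decode (set_encode D) \<and> m \<le> d)"
  proof (rule generic_meets_dense[OF decp_clean_at[OF oracle_B]])
    show "{h. \<exists>d<h. d \<in> set_decode h \<and> m \<le> d} \<in> Sigma0 n (A0 \<oplus>\<^sub>T A1)"
      by (intro decp_Sigma0 comp_intros)
    fix D S assume "ideal_condition I (D, S)"
    from clean_dense[OF this] obtain D' S' d where D': "ideal_condition I (D', S')"
      "extends (D', S') (D, S)" "clean R D' S'" "d \<in> D'" "m \<le> d" by blast
    moreover have "d \<in> set_decode (set_encode D')" using conditionD(1)[OF D'(1)] D'(4) by simp
    ultimately show "\<exists>D' S'. ideal_condition I (D', S') \<and> extends (D', S') (D, S) \<and>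
        (\<forall>x\<in>S'. \<forall>y\<in>S'. x \<le> y \<longrightarrow> clean_at R (final_state R (set_decode (set_encode D'))) x y) \<and>
        (\<exists>d<set_encode D'. d \<in> set_decode (set_encode D') \<and> m \<le> d)"
      using clean_iff set_decode_less by blast
  qed
  then show ?thesis using clean_iff conditionD(1) by (metis set_encode_inverse)
qed

text \<open>If G meets K, the generated set satisfies a member of C. If G avoids K, the avoiding
  condition is merged with a clean one that G satisfies. The computable condition forced by the
  merged one has no extension in C, since \<open>clean_push\<close> would turn such an extension
  into an extension in K.\<close>

lemma generated_generic: "mathias_generic n COMP {} {} (generated R G)"
  unfolding mathias_generic_def
proof (intro allI impI)
  fix C assume C: "Sigma0_collection n COMP {} {} C"
  have ideal_C: "ideal_condition COMP p" if "p \<in> C" for p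
    using C that by (auto simp: Sigma0_collection_def)
  define ind where "ind = {i. \<exists>p\<in>C. condition_index {} {} i p}"
  have ind: "ind \<in> Sigma0 n (A0 \<oplus>\<^sub>T A1)"
    using C Sigma0_oracle_mono[OF empty_turing_le]
    unfolding Sigma0_collection_def ind_def empty_join_empty by blast
  define top where "top \<sigma> = pi1 (st_s \<sigma> - 1)" for \<sigma>
  \<comment> \<open>The finite part stored in the top entry may be outdated, because entries above
    it may have enlarged h before being popped. The index tested therefore combines the current h
    with the programs of the top entry.\<close>
  define N where "N h \<longleftrightarrow> st_s (final_state R (set_decode h)) \<noteq> 0 \<and>
    pe (st_h (final_state R (set_decode h))) (pi2 (top (final_state R (set_decode h)))) \<in> ind" for h
  define K where "K = {(D, S). ideal_condition I (D, S) \<and>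
       (\<forall>x\<in>S. \<forall>y\<in>S. x \<le> y \<longrightarrow> clean_at R (final_state R (set_decode (set_encode D))) x y) \<and> N (set_encode D)}"
  have K_iff: "(D, S) \<in> K \<longleftrightarrow> ideal_condition I (D, S) \<and> clean R D S \<and> st_s (final_state R D) \<noteq> 0 \<and>
      pe (st_h (final_state R D)) (pi2 (top (final_state R D))) \<in> ind" for D S
    using clean_iff conditionD(1) by (auto simp: K_def N_def)
  note fin = compf_final_state[OF oracle_B]
  have "{h. st_s (final_state R (set_decode h)) \<noteq> 0} \<in> Sigma0 n (A0 \<oplus>\<^sub>T A1)"
    unfolding st_s_def by (intro decp_Sigma0 comp_intros fin)
  moreover have "{h. pe (st_h (final_state R (set_decode h))) (pi2 (top (final_state R (set_decode h)))) \<in> ind}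
      \<in> Sigma0 n (A0 \<oplus>\<^sub>T A1)"
    unfolding st_h_def st_s_def top_def by (intro Sigma0_preimage[OF ind] comp_intros fin)
  ultimately have "{h. N h} \<in> Sigma0 n (A0 \<oplus>\<^sub>T A1)"
    unfolding N_def Collect_conj_eq by (rule Sigma0_Int)
  then have "Sigma0_collection n I A0 A1 K"
    by (rule Sigma0_collectionI[OF exact n decp_clean_at[OF oracle_B] _ K_def])
  then have "meets G K \<or> avoids I G K" using generic unfolding mathias_generic_def by blast
  then show "meets (generated R G) C \<or> avoids COMP (generated R G) C"
  proof
    assume "meets G K"
    then obtain D S where DS: "(D, S) \<in> K" "satisfies G (D, S)" by (auto simp: meets_def)
    define \<sigma> where "\<sigma> = final_state R D"
    let ?i = "pe (st_h \<sigma>) (pi2 (top \<sigma>))"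
    have cond: "ideal_condition I (D, S)" and cl: "clean R D S" and s: "st_s \<sigma> \<noteq> 0" and i: "?i \<in> ind"
      using DS(1) K_iff unfolding \<sigma>_def by blast+
    obtain p where p: "p \<in> C" "condition_index {} {} ?i p" using i by (auto simp: ind_def)
    have "p = indexed ?i" by (rule condition_index_indexed[OF ideal_C[OF p(1)] p(2)])
    moreover have "top \<sigma> \<in> stack_items (st_s \<sigma>)"
      using hd_list_decode[OF s] list_decode_eq_Nil_iff[of "st_s \<sigma>"] s hd_in_set
      unfolding top_def stack_items_def by metis
    then have "index_mem ?i y" if "y \<in> stack_set (st_s \<sigma>)" for y
      using that unfolding stack_set_iff index_mem_def by simp
    ultimately have "satisfies (generated R G) p"
      using clean_generated[OF conditionD(5)[OF cond] cl DS(2)]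
      by (auto simp: satisfies_def indexed_def \<sigma>_def)
    then show ?thesis using p(1) by (auto simp: meets_def)
  next
    assume "avoids I G K"
    then obtain D0 S0 where cond0: "ideal_condition I (D0, S0)" and sat0: "satisfies G (D0, S0)"
      and avoid: "\<And>q. q \<in> K \<Longrightarrow> \<not> extends q (D0, S0)" by (auto simp: avoids_def)
    obtain D S d where cond: "ideal_condition I (D, S)" and sat: "satisfies G (D, S)"
      and cl: "clean R D S" and d: "d \<in> D" "set_encode D0 \<le> d" using meets_clean by blast
    \<comment> \<open>The element d of D lies beyond D0, and S lies above d, so S misses D0.\<close>
    have "D0 \<subseteq> D"
    proof
      fix x assume x: "x \<in> D0"
      then have "x < d"
        using set_decode_less[of x "set_encode D0"] conditionD(1)[OF cond0] d(2) by simp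
      then have "x \<notin> S" using conditionD(4)[OF cond d(1)] by (meson less_asym)
      then show "x \<in> D" using x sat0 sat by (auto simp: satisfies_def)
    qed
    \<comment> \<open>Both reservoirs contain almost all of the infinite set G, so their
      intersection can serve as a reservoir.\<close>
    have "infinite G"
      using generic_unbounded unfolding infinite_nat_iff_unbounded_le by blast
    then have "infinite (G - (D \<union> D0))" using conditionD(1)[OF cond] conditionD(1)[OF cond0] by simp
    moreover have "G - (D \<union> D0) \<subseteq> S \<inter> S0" using sat sat0 by (auto simp: satisfies_def)
    ultimately have "infinite (S \<inter> S0)" using finite_subset by blast
    moreover have "S \<inter> S0 \<in> I"
    proof -
      have "decp (S \<oplus>\<^sub>T S0) (\<lambda>x. x \<in> S \<and> x \<in> S0)"
        by (intro comp_intros decp_mem turing_le_join)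
      from ideal_decp[OF ideal_join this] show ?thesis
        using conditionD(3)[OF cond] conditionD(3)[OF cond0] by (simp add: Int_def)
    qed
    ultimately have cond1: "ideal_condition I (D, S \<inter> S0)"
      using cond by (auto simp: ideal_condition_def mathias_condition_def)
    have cl1: "clean R D (S \<inter> S0)" using cl by (simp add: clean_def)
    have ext1: "extends (D, S \<inter> S0) (D0, S0)"
      using \<open>D0 \<subseteq> D\<close> sat sat0 by (auto simp: extends_def satisfies_def)
    define \<sigma> where "\<sigma> = final_state R D"
    define E T where "E = set_decode (st_h \<sigma>)"
      and "T = {y \<in> stack_set (st_s \<sigma>). \<forall>d\<in>set_decode (st_h \<sigma>). d < y}"
    have "satisfies (generated R G) (E, T)"
      unfolding E_def T_def \<sigma>_def by (rule clean_generated[OF conditionD(5)[OF cond] cl sat])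
    moreover have "ideal_condition COMP (E, T)"
    proof -
      note st = stack_set_computable[of "st_s \<sigma>", OF clean_good[OF cond cl, folded \<sigma>_def]]
      have "decp {} (\<lambda>y. y \<in> T)"
        unfolding T_def mem_Collect_eq Ball_set_decode by (intro comp_intros decp_mem[OF st(1)])
      then have "T \<in> COMP" by (simp add: COMP_def turing_le_decp)
      moreover have "infinite T"
      proof
        assume "finite T"
        \<comment> \<open>Elements of the set coded by \<open>st_h \<sigma>\<close> are smaller than
          the code, so the cut removes only finitely many numbers.\<close>
        moreover have "stack_set (st_s \<sigma>) \<subseteq> T \<union> {..st_h \<sigma>}"
          using set_decode_less unfolding T_def by (fastforce simp: not_le)
        ultimately show False using st(2) finite_subset by blast
      qed
      ultimately show ?thesis
        by (auto simp: ideal_condition_def mathias_condition_def E_def T_def)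
    qed
    moreover have "\<not> extends p (E, T)" if p: "p \<in> C" for p
    proof
      assume x: "extends p (E, T)"
      obtain a where a: "condition_index {} {} a p" using comp_index_exists[OF ideal_C[OF p]] ..
      have "comp_index a" unfolding comp_index_def using a ideal_C[OF p] by blast
      moreover have "extends (indexed a) (E, T)"
        using x condition_index_indexed[OF ideal_C[OF p] a] by simp
      ultimately obtain D' S' where D': "ideal_condition I (D', S')"
        "extends (D', S') (D, S \<inter> S0)" "clean R D' S'"
        "st_h (final_state R D') = pi1 a" "st_s (final_state R D') = stack_push a (st_s \<sigma>)"
        using clean_push[OF cond1 cl1, of a] unfolding E_def T_def \<sigma>_def by blast
      have "a \<in> ind" using a p by (auto simp: ind_def)
      \<comment> \<open>After the push h is \<open>pi1 a\<close> and the top entry is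
        \<open>a\<close>, so the index tested by N is \<open>a\<close> itself.\<close>
      then have "(D', S') \<in> K" using D' by (simp add: K_iff top_def stack_push_def)
      then show False using avoid D'(2) ext1 extends_trans by blast
    qed
    ultimately show ?thesis unfolding avoids_def by blast
  qed
qed

end

theorem theorem5p6:
  fixes I :: "nat set set" and A0 A1 G :: "nat set" and n :: nat
  assumes "turing_ideal I"
    and "exact_pair I A0 A1"
    and "n \<ge> 3"
    and "mathias_generic n I A0 A1 G"
  shows "\<exists>H. H \<le>\<^sub>T G \<and> mathias_generic n COMP {} {} H"
proof -
  interpret generic_set I A0 A1 G n using assms by unfold_locales
  show ?thesis
  proof (cases "\<exists>B R. B \<in> I \<and> B \<le>\<^sub>T G \<and> decp B (\<lambda>p. R (pi1 p) (pi2 p)) \<and> {u. \<exists>t. R u t} \<notin> I")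
    case True
    then obtain B R where "B \<in> I" "B \<le>\<^sub>T G" "decp B (\<lambda>p. R (pi1 p) (pi2 p))" "{u. \<exists>t. R u t} \<notin> I"
      by blast
    then interpret generic_set_coding I A0 A1 G n B R by unfold_locales
    show ?thesis using generated_le generated_generic by blast
  next
    case False
    then interpret generic_set_jump_closed I A0 A1 G n by unfold_locales blast
    show ?thesis by (rule exists_comp_generic)
  qed
qed

end
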